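(* Let $\beta=\frac12+\frac{\log(5/3)}{\log 4}$. (a) Let $F\in\mathrm{dom}\,\mathcal{E}$. Then $T_mF\in H^\beta(\mathrm{SG}_m)$ for all $m\ge0$ with uniformly bounded norms, and $$\sup_m\|T_mF\|_{H^\beta(\mathrm{SG}_m)}^2\le c\,\mathcal{E}(F).$$ (b) Let $f_m\in H^\beta(\mathrm{SG}_m)$, $m\ge 0$, be a sequence of functions with uniformly bounded norms satisfying the consistency condition $T_mf_{m'}=f_m$ whenever $m\le m'$. Then there exists $F\in\mathrm{dom}\,\mathcal{E}$ such that $T_mF=f_m$ for all $m$ and $$\mathcal{E}(F)\le c\sup_m\|f_m\|_{H^\beta(\mathrm{SG}_m)}^2 .$$ Here $c$ is a constant independent of $F$, $\{f_m\}$ and $m$.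
   Context: Let $q_0,q_1,q_2$ be the vertices of an equilateral triangle of side length $1$ in the plane, and $\Phi_i(x)=\frac12x+\frac12q_i$. The Sierpinski gasket $\mathrm{SG}$ is the unique nonempty compact set with $\mathrm{SG}=\bigcup_{i=0}^2\Phi_i(\mathrm{SG})$. For a word $w=(w_1,\dots,w_m)\in\{0,1,2\}^m$ write $|w|=m$ and $\Phi_w=\Phi_{w_1}\circ\cdots\circ\Phi_{w_m}$. For a function $f$ on $\mathrm{SG}$ let $E_m(f)=\sum_{i\ne j}\sum_{|w|=m}|f(\Phi_wq_i)-f(\Phi_wq_j)|^2$ and $\mathcal{E}(f)=\lim_{m\to\infty}(5/3)^mE_m(f)$ (the sequence is nondecreasing); $\mathrm{dom}\,\mathcal{E}$ is the space of functions (continuous on $\mathrm{SG}$) for which this limit is finite. $\mathrm{SG}_m$ is the metric graph whose vertices are the points $\Phi_wq_i$ ($|w|=m$) and whose edges are the segments $\Phi_w(e_{ij})$, $|w|=m$, where $e_{ij}$ is the side of the original triangle joining $q_i$ and $q_j$, each of length $2^{-m}$; these graphs are nested, $\mathrm{SG}_m\subset\mathrm{SG}_{m'}$ for $m\le m'$, and $T_m$ denotes restriction to $\mathrm{SG}_m$ (of functions on $\mathrm{SG}$ or on $\mathrm{SG}_{m'}$, $m'\ge m$). For a metric graph $G$ with edges $e$ of length $L_e$ parametrized by arclength $x\mapsto e(x)$, $H^\beta(G)$ is the space of continuous functions $F$ on $G$ (modulo constants) with $$\|F\|_{H^\beta(G)}^2=\sum_{e}\int_0^{L_e}\int_0^{L_e}\frac{|F(e(x))-F(e(y))|^2}{|x-y|^{1+2\beta}}\,dx\,dy<\infty.$$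 *)

theory Defs
  imports "HOL-Analysis.Analysis"
begin

text \<open>The plane is modelled by the complex numbers. Vertices of the unit equilateral triangle.\<close>
definition q :: "nat \<Rightarrow> complex" where
  "q i = (if i = 0 then 0 else if i = 1 then 1 else Complex (1/2) (sqrt 3 / 2))"

definition Phi :: "nat \<Rightarrow> complex \<Rightarrow> complex" where
  "Phi i x = x / 2 + q i / 2"

fun Phiw :: "nat list \<Rightarrow> complex \<Rightarrow> complex" where
  "Phiw [] = id"
| "Phiw (i # w) = Phi i \<circ> Phiw w"

definition words :: "nat \<Rightarrow> nat list set" where
  "words m = {w. length w = m \<and> set w \<subseteq> {0,1,2}}"

definition SG :: "complex set" where
  "SG = (THE K. compact K \<and> K \<noteq> {} \<and> K = (\<Union>i\<in>{0,1,2}. Phi i ` K))"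

definition Em :: "nat \<Rightarrow> (complex \<Rightarrow> real) \<Rightarrow> real" where
  "Em m f = (\<Sum>(i,j)\<in>{(i,j). i \<in> {0,1,2} \<and> j \<in> {0,1,2::nat} \<and> i \<noteq> j}.
               \<Sum>w\<in>words m. \<bar>f (Phiw w (q i)) - f (Phiw w (q j))\<bar>\<^sup>2)"

definition dom_E :: "(complex \<Rightarrow> real) set" where
  "dom_E = {f. continuous_on SG f \<and> convergent (\<lambda>m. (5/3::real)^m * Em m f)}"

definition Energy :: "(complex \<Rightarrow> real) \<Rightarrow> real" where
  "Energy f = lim (\<lambda>m. (5/3::real)^m * Em m f)"

text \<open>Edge Phi_w(e_ij) of SG_m (i<j), parametrized by arclength x in [0, 2^-m].\<close>
definition edge :: "nat list \<Rightarrow> nat \<Rightarrow> nat \<Rightarrow> real \<Rightarrow> complex" where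
  "edge w i j x = Phiw w (q i) + of_real x * (q j - q i)"

definition edges :: "nat \<Rightarrow> (nat list \<times> nat \<times> nat) set" where
  "edges m = {(w,i,j). w \<in> words m \<and> i < j \<and> j \<le> (2::nat)}"

definition edge_len :: "nat \<Rightarrow> real" where
  "edge_len m = (1/2) ^ m"

definition SGm :: "nat \<Rightarrow> complex set" where
  "SGm m = (\<Union>(w,i,j)\<in>edges m. edge w i j ` {0..edge_len m})"

definition beta :: real where
  "beta = 1/2 + ln (5/3) / ln 4"

definition Hnorm2 :: "nat \<Rightarrow> (complex \<Rightarrow> real) \<Rightarrow> ennreal" where
  "Hnorm2 m F = (\<Sum>(w,i,j)\<in>edges m.
     \<integral>\<^sup>+ x. \<integral>\<^sup>+ y. indicator {0..edge_len m} x * indicator {0..edge_len m} y *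
        ennreal (\<bar>F (edge w i j x) - F (edge w i j y)\<bar>\<^sup>2 / \<bar>x - y\<bar> powr (1 + 2 * beta))
     \<partial>lborel \<partial>lborel)"

definition Hbeta :: "nat \<Rightarrow> (complex \<Rightarrow> real) set" where
  "Hbeta m = {F. continuous_on (SGm m) F \<and> Hnorm2 m F < \<infinity>}"

end

(* The exponent is chosen so that 2^(2 beta - 1) = 5/3, the energy renormalization factor.  On one edge
   the H^beta seminorm is therefore comparable with the sum over n of (5/3)^n times the squared
   increments between neighbouring dyadic points of level n: the upper bound by chaining through
   dyadic points, while the endpoint increment is bounded below by telescoping averages over
   halving intervals.

   For (a), the dyadic sums along the edges must be bounded although the cell energies alone do not
   decay.  A harmonic function loses a fixed share of its energy to the child cell away from the edge,
   so (5/3)(D_wi + D_wj) is at most r D_w plus a multiple of the energy excess of the subdivision,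
   with r < 1; the excesses telescope to the total energy.

   For (b), the endpoint estimate on each edge bounds the graph energies, hence the oscillation on
   cells, and since distinct cells of equal level meet only in vertices the values at the vertices
   extend continuously to the closure, which is SG. *)

theory Submission
  imports Defs
begin

section \<open>Cells and energy\<close>

text \<open>The obstacle in (a): a priori the cells along an edge may carry, at every level, a share
  of the renormalised energy comparable to the whole. Bounding each increment by the energy of its
  cell then gives a divergent sum over levels. The cure is one quadratic inequality. Let d be the
  squared increment along the edge, k the corner off the edge and e = (5/3)(D_wi + D_wj + D_wk) -
  D_w the excess. Then (5/3)(D_wi + D_wj) + d/30 \<le> D_w + (7/5) e. So d itself is what the cells
  along the edge lose, and summation over levels leaves 30 times the initial cell energy plus 42
  times the total excess. The constants do not depend on m because the scaling is exact: an edge of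
  length 2^-m contributes (5/3)^m times the seminorm of its reparametrization by the unit interval,
  and (5/3)^m is also the factor of the level m energy.\<close>

definition cell_energy :: "(complex \<Rightarrow> real) \<Rightarrow> nat list \<Rightarrow> real" where
  "cell_energy f w = (f (Phiw w (q 0)) - f (Phiw w (q 1)))\<^sup>2
     + (f (Phiw w (q 1)) - f (Phiw w (q 2)))\<^sup>2 + (f (Phiw w (q 0)) - f (Phiw w (q 2)))\<^sup>2"

lemma cell_energy_nonneg: "0 \<le> cell_energy f w"
  by (simp add: cell_energy_def)

lemma Phiw_append: "Phiw (u @ v) x = Phiw u (Phiw v x)"
  by (induction u) auto

lemma Phiw_affine: "Phiw w (x + of_real t * d) = Phiw w x + of_real (t / 2 ^ length w) * d"
proof (induction w)
  case (Cons i w)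
  then show ?case by (simp add: Phi_def field_simps)
qed simp

lemma Phi_q_self: "Phi i (q i) = q i"
  by (simp add: Phi_def)

lemma Phi_q_commute: "Phi i (q j) = Phi j (q i)"
  by (simp add: Phi_def)

lemma Phiw_snoc_q_self: "Phiw (w @ [i]) (q i) = Phiw w (q i)"
  by (simp add: Phiw_append Phi_q_self)

lemma finite_words: "finite (words m)"
  unfolding words_def using finite_lists_length_eq[of "{0,1,2::nat}" m]
  by (rule rev_finite_subset) auto

lemma words_0: "words 0 = {[]}"
  by (auto simp: words_def)

lemma words_Suc: "words (Suc m) = (\<lambda>(c, v). c # v) ` ({0,1,2} \<times> words m)"
proof (intro set_eqI)
  fix w
  show "w \<in> words (Suc m) \<longleftrightarrow> w \<in> (\<lambda>(c, v). c # v) ` ({0,1,2} \<times> words m)"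
    by (cases w) (auto simp: words_def image_iff)
qed

lemma snoc_in_words: "w \<in> words m \<Longrightarrow> c \<in> {0,1,2} \<Longrightarrow> w @ [c] \<in> words (Suc m)"
  by (auto simp: words_def)

lemma sum_words_Suc:
  fixes h :: "nat list \<Rightarrow> 'a::comm_monoid_add"
  shows "(\<Sum>w\<in>words (Suc m). h w) = (\<Sum>c\<in>{0,1,2}. \<Sum>v\<in>words m. h (c # v))"
  unfolding words_Suc
  by (subst sum.reindex) (auto simp: inj_on_def sum.cartesian_product case_prod_unfold)

lemma sum_words_add:
  fixes h :: "nat list \<Rightarrow> 'a::comm_monoid_add"
  shows "(\<Sum>u\<in>words (m + n). h u) = (\<Sum>w\<in>words m. \<Sum>v\<in>words n. h (w @ v))"
proof (induction m arbitrary: h)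
  case (Suc m)
  show ?case by (simp add: sum_words_Suc Suc.IH del: sum.insert)
qed (simp add: words_0)

text \<open>The factor 2 arises because \<open>Em\<close> runs over ordered pairs of
  corners.\<close>

lemma Em_eq_sum_cell_energy: "Em m f = 2 * (\<Sum>w\<in>words m. cell_energy f w)"
proof -
  have *: "{(i,j). i \<in> {0,1,2} \<and> j \<in> {0,1,2::nat} \<and> i \<noteq> j} = {(0,1),(1,0),(0,2),(2,0),(1,2),(2,1)}"
    by auto
  show ?thesis
    unfolding Em_def * cell_energy_def
    by (simp add: sum_distrib_left sum.distrib power2_commute algebra_simps)
qed

section \<open>Energy under one subdivision of a cell\<close>

lemma cell_energy_child_le:
  fixes a b c x y z :: real
  shows "(a-b)\<^sup>2 + (b-c)\<^sup>2 + (a-c)\<^sup>2 \<le> 5/3 *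
     (((a-x)\<^sup>2 + (x-z)\<^sup>2 + (a-z)\<^sup>2) + ((x-b)\<^sup>2 + (b-y)\<^sup>2 + (x-y)\<^sup>2) + ((z-y)\<^sup>2 + (y-c)\<^sup>2 + (z-c)\<^sup>2))"
proof -
  \<comment> \<open>The deviations of the midpoint values from the harmonic extension, given by the
    2/5-2/5-1/5 rule. The excess is 5/3 times the energy of this deviation, which vanishes at the
    three corners.\<close>
  let ?u = "x - (2*a+2*b+c)/5" and ?v = "y - (2*b+2*c+a)/5" and ?w = "z - (2*a+2*c+b)/5"
  have "5/3 * (((a-x)\<^sup>2 + (x-z)\<^sup>2 + (a-z)\<^sup>2) + ((x-b)\<^sup>2 + (b-y)\<^sup>2 + (x-y)\<^sup>2) + ((z-y)\<^sup>2 + (y-c)\<^sup>2 + (z-c)\<^sup>2))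
     - ((a-b)\<^sup>2 + (b-c)\<^sup>2 + (a-c)\<^sup>2)
    = 5/3 * (2*?u\<^sup>2 + 2*?v\<^sup>2 + 2*?w\<^sup>2 + (?u-?v)\<^sup>2 + (?v-?w)\<^sup>2 + (?u-?w)\<^sup>2)"
    by (simp add: power2_eq_square field_simps)
  also have "\<dots> \<ge> 0" by simp
  finally show ?thesis by simp
qed

text \<open>A nonconstant harmonic function is nonconstant on every child cell, so the child away from the
  edge keeps a fixed share of the energy, up to the energy excess of the subdivision. The sum of
  squares is an LDL decomposition of the quadratic form.\<close>
lemma edge_children_energy_le:
  fixes a b c x y z :: real
  shows "(a-b)\<^sup>2 + 12 * ((a-b)\<^sup>2 + (b-c)\<^sup>2 + (a-c)\<^sup>2) \<le> 5/3 *
     (12 * ((a-x)\<^sup>2 + (x-z)\<^sup>2 + (a-z)\<^sup>2) + 12 * ((x-b)\<^sup>2 + (b-y)\<^sup>2 + (x-y)\<^sup>2)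
       + 42 * ((z-y)\<^sup>2 + (y-c)\<^sup>2 + (z-c)\<^sup>2))"
proof -
  let ?a = "a-c" and ?b = "b-c" and ?x = "x-c" and ?y = "y-c" and ?z = "z-c"
  have "105 * (5/3 * (12 * ((a-x)\<^sup>2 + (x-z)\<^sup>2 + (a-z)\<^sup>2) + 12 * ((x-b)\<^sup>2 + (b-y)\<^sup>2 + (x-y)\<^sup>2)
       + 42 * ((z-y)\<^sup>2 + (y-c)\<^sup>2 + (z-c)\<^sup>2)) - ((a-b)\<^sup>2 + 12 * ((a-b)\<^sup>2 + (b-c)\<^sup>2 + (a-c)\<^sup>2)))
     = 7 * (15*?a + 13*?b - 20*?x - 20*?z)\<^sup>2 + 2 * (14*?b - 10*?x - 75*?y + 65*?z)\<^sup>2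
       + 600 * (3*?x - 2*?y - 2*?z)\<^sup>2 + 5250 * ?y\<^sup>2 + 5250 * ?z\<^sup>2"
    by (simp add: power2_eq_square algebra_simps)
  also have "\<dots> \<ge> 0" by simp
  finally show ?thesis by simp
qed

lemma cell_energy_children:
  shows "cell_energy f (w @ [0]) = (f (Phiw w (q 0)) - f (Phiw w (Phi 0 (q 1))))\<^sup>2
      + (f (Phiw w (Phi 0 (q 1))) - f (Phiw w (Phi 0 (q 2))))\<^sup>2 + (f (Phiw w (q 0)) - f (Phiw w (Phi 0 (q 2))))\<^sup>2"
    and "cell_energy f (w @ [1]) = (f (Phiw w (Phi 0 (q 1))) - f (Phiw w (q 1)))\<^sup>2
      + (f (Phiw w (q 1)) - f (Phiw w (Phi 1 (q 2))))\<^sup>2 + (f (Phiw w (Phi 0 (q 1))) - f (Phiw w (Phi 1 (q 2))))\<^sup>2"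
    and "cell_energy f (w @ [2]) = (f (Phiw w (Phi 0 (q 2))) - f (Phiw w (Phi 1 (q 2))))\<^sup>2
      + (f (Phiw w (Phi 1 (q 2))) - f (Phiw w (q 2)))\<^sup>2 + (f (Phiw w (Phi 0 (q 2))) - f (Phiw w (q 2)))\<^sup>2"
  unfolding cell_energy_def Phiw_append
  by (simp_all add: Phi_q_self Phi_q_commute[of 1 0] Phi_q_commute[of 2 0] Phi_q_commute[of 2 1]
      Phi_q_commute[of "Suc 0" 0] Phi_q_commute[of 2 "Suc 0"])

text \<open>Normalised relative to the cell \<open>w\<close>: the factor
  (5/3)^\<open>length w\<close> is left out, so that the value at N = 0 is the cell energy and
  harmonic extension inside the cell keeps it constant in N.\<close>

definition subcell_energy :: "(complex \<Rightarrow> real) \<Rightarrow> nat \<Rightarrow> nat list \<Rightarrow> real" where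
  "subcell_energy f N w = (5/3)^N * (\<Sum>v\<in>words N. cell_energy f (w @ v))"

lemma subcell_energy_0: "subcell_energy f 0 w = cell_energy f w"
  by (simp add: subcell_energy_def words_0)

lemma subcell_energy_Suc:
  "subcell_energy f (Suc N) w = 5/3 * (subcell_energy f N (w @ [0]) + subcell_energy f N (w @ [1])
     + subcell_energy f N (w @ [2]))"
  by (simp add: subcell_energy_def sum_words_Suc algebra_simps)

lemma cell_energy_le_subcell_energy: "cell_energy f w \<le> subcell_energy f N w"
proof (induction N arbitrary: w)
  case (Suc N)
  have "cell_energy f w \<le> 5/3 * (cell_energy f (w @ [0]) + cell_energy f (w @ [1]) + cell_energy f (w @ [2]))"
    unfolding cell_energy_children unfolding cell_energy_def by (rule cell_energy_child_le)
  also have "\<dots> \<le> subcell_energy f (Suc N) w"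
    unfolding subcell_energy_Suc using Suc[of "w @ [0]"] Suc[of "w @ [1]"] Suc[of "w @ [2]"] by simp
  finally show ?case .
qed (simp add: subcell_energy_0)

lemma sum_subcell_energy:
  "(5/3)^m * (\<Sum>w\<in>words m. subcell_energy f N w) = (5/3)^(m+N) * Em (m + N) f / 2"
  by (simp add: Em_eq_sum_cell_energy sum_words_add subcell_energy_def power_add mult.assoc
      flip: sum_distrib_left)

lemma incseq_Em: "incseq (\<lambda>m. (5/3::real)^m * Em m f)"
proof (rule incseq_SucI)
  fix m
  have "(5/3::real)^m * Em m f = 2 * ((5/3)^m * (\<Sum>w\<in>words m. cell_energy f w))"
    by (simp add: Em_eq_sum_cell_energy)
  also have "\<dots> \<le> 2 * ((5/3)^m * (\<Sum>w\<in>words m. subcell_energy f 1 w))"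
    by (intro mult_left_mono sum_mono cell_energy_le_subcell_energy) auto
  also have "\<dots> = (5/3::real)^Suc m * Em (Suc m) f"
    unfolding sum_subcell_energy by simp
  finally show "(5/3::real)^m * Em m f \<le> (5/3)^Suc m * Em (Suc m) f" .
qed

text \<open>The three edges of a cell differ by a relabelling of corners and midpoints, so one
  quadratic inequality serves all of them. Here k is the corner off the edge.\<close>

lemma edge_children_cell_energy_le:
  assumes "(i, j, k) \<in> {(0,1,2), (0,2,1), (1,2,0)}"
  shows "(f (Phiw w (q j)) - f (Phiw w (q i)))\<^sup>2 + 12 * cell_energy f w
    \<le> 5/3 * (12 * (cell_energy f (w @ [i]) + cell_energy f (w @ [j])) + 42 * cell_energy f (w @ [k]))"
proof -
  \<comment> \<open>With the squares hidden behind \<open>D\<close>, each case is linear in atoms,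
    and the relabelling needs only the symmetry of \<open>D\<close>.\<close>
  define D where "D s t = (s - t)\<^sup>2" for s t :: real
  have D_commute: "D s t = D t s" for s t by (simp add: D_def power2_commute)
  define a b c x y z where "a = f (Phiw w (q 0))" and "b = f (Phiw w (q 1))" and "c = f (Phiw w (q 2))"
    and "x = f (Phiw w (Phi 0 (q 1)))" and "y = f (Phiw w (Phi 1 (q 2)))" and "z = f (Phiw w (Phi 0 (q 2)))"
  note defs = a_def b_def c_def x_def y_def z_def
  have w: "cell_energy f w = D a b + D b c + D a c"
    unfolding cell_energy_def D_def defs ..
  have ch: "cell_energy f (w @ [0]) = D a x + D x z + D a z"
    "cell_energy f (w @ [1]) = D x b + D b y + D x y"
    "cell_energy f (w @ [2]) = D z y + D y c + D z c"
    unfolding cell_energy_children D_def defs by (rule refl)+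
  have v: "f (Phiw w (q 0)) = a" "f (Phiw w (q 1)) = b" "f (Phiw w (q 2)) = c"
    by (simp_all add: defs)
  have le: "D a b + 12 * (D a b + D b c + D a c) \<le> 5/3 * (12 * (D a x + D x z + D a z)
      + 12 * (D x b + D b y + D x y) + 42 * (D z y + D y c + D z c))" for a b c x y z
    unfolding D_def by (rule edge_children_energy_le)
  note comm = D_commute[of b a] D_commute[of c a] D_commute[of c b] D_commute[of y x] D_commute[of z x]
    D_commute[of z y] D_commute[of x a] D_commute[of x b] D_commute[of y b] D_commute[of y c]
    D_commute[of z a] D_commute[of z c]
  consider "(i,j,k) = (0,1,2)" | "(i,j,k) = (0,2,1)" | "(i,j,k) = (1,2,0)" using assms by auto
  then show ?thesis
  proof cases
    case 1
    then have ijk: "i = 0" "j = 1" "k = 2" by auto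
    show ?thesis
      unfolding ijk w ch v D_def[symmetric] using le[of a b c x z y] comm by argo
  next
    case 2
    then have ijk: "i = 0" "j = 2" "k = 1" by auto
    show ?thesis
      unfolding ijk w ch v D_def[symmetric] using le[of a c b z x y] comm by argo
  next
    case 3
    then have ijk: "i = 1" "j = 2" "k = 0" by auto
    show ?thesis
      unfolding ijk w ch v D_def[symmetric] using le[of b c a y x z] comm by argo
  qed
qed

section \<open>Dyadic increments along an edge\<close>

definition dyadic_sum :: "nat \<Rightarrow> (real \<Rightarrow> real) \<Rightarrow> real" where
  "dyadic_sum n g = (\<Sum>k<2^n. (g (real (Suc k) / 2^n) - g (real k / 2^n))\<^sup>2)"

lemma dyadic_sum_nonneg: "0 \<le> dyadic_sum n g"
  by (simp add: dyadic_sum_def sum_nonneg)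

lemma dyadic_sum_0: "dyadic_sum 0 g = (g 1 - g 0)\<^sup>2"
  by (simp add: dyadic_sum_def)

lemma sum_lessThan_add:
  fixes h :: "nat \<Rightarrow> 'a::comm_monoid_add"
  shows "(\<Sum>k<m + n. h k) = (\<Sum>k<m. h k) + (\<Sum>k<n. h (m + k))"
  by (induction n) (simp_all add: add.assoc)

text \<open>Splitting off the coarsest level, not the finest, matches the passage from a cell to its
  two children along the edge.\<close>

lemma dyadic_sum_Suc:
  "dyadic_sum (Suc n) g = dyadic_sum n (\<lambda>t. g (t / 2)) + dyadic_sum n (\<lambda>t. g ((1 + t) / 2))"
proof -
  let ?h = "\<lambda>k. (g (real (Suc k) / 2^Suc n) - g (real k / 2^Suc n))\<^sup>2"
  have "(2::nat) ^ Suc n = 2 ^ n + 2 ^ n" by simp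
  then have "dyadic_sum (Suc n) g = (\<Sum>k<2^n + 2^n. ?h k)" by (simp only: dyadic_sum_def)
  also have "\<dots> = (\<Sum>k<2^n. ?h k) + (\<Sum>k<2^n. ?h (2^n + k))"
    by (rule sum_lessThan_add)
  also have "(\<Sum>k<2^n. ?h k) = dyadic_sum n (\<lambda>t. g (t / 2))"
    by (simp add: dyadic_sum_def divide_divide_eq_left mult.commute)
  also have "(\<Sum>k<2^n. ?h (2^n + k)) = dyadic_sum n (\<lambda>t. g ((1 + t) / 2))"
    unfolding dyadic_sum_def
  proof (rule sum.cong[OF refl])
    fix k
    have "real (Suc (2^n + k)) / 2^Suc n = (1 + real (Suc k) / 2^n) / 2"
      "real (2^n + k) / 2^Suc n = (1 + real k / 2^n) / 2"
      by (simp_all add: field_simps)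
    then show "?h (2^n + k) = (g ((1 + real (Suc k) / 2^n) / 2) - g ((1 + real k / 2^n) / 2))\<^sup>2"
      by (simp only:)
  qed
  finally show ?thesis .
qed

text \<open>Rescaling to the unit interval makes the two halves of an edge the edges of the children
  \<open>w @ [i]\<close> and \<open>w @ [j]\<close>, with the same \<open>i\<close>,
  \<open>j\<close> and the same orientation.\<close>

definition edge_fun :: "(complex \<Rightarrow> real) \<Rightarrow> nat list \<Rightarrow> nat \<Rightarrow> nat \<Rightarrow> real \<Rightarrow> real" where
  "edge_fun f w i j t = f (edge w i j (t / 2 ^ length w))"

lemma edge_conv_Phiw: "edge w i j (t / 2 ^ length w) = Phiw w (q i + of_real t * (q j - q i))"
  by (simp add: edge_def Phiw_affine)

lemma edge_fun_left: "edge_fun f w i j (t / 2) = edge_fun f (w @ [i]) i j t"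
  unfolding edge_fun_def edge_conv_Phiw by (simp add: Phiw_append Phi_def field_simps)

lemma edge_fun_right: "edge_fun f w i j ((1 + t) / 2) = edge_fun f (w @ [j]) i j t"
  unfolding edge_fun_def edge_conv_Phiw by (simp add: Phiw_append Phi_def field_simps)

lemma edge_fun_0: "edge_fun f w i j 0 = f (Phiw w (q i))"
  by (simp add: edge_fun_def edge_def)

lemma edge_fun_1: "edge_fun f w i j 1 = f (Phiw w (q j))"
  unfolding edge_fun_def edge_conv_Phiw by simp

text \<open>With S and D for the subcell and cell energies of \<open>w\<close>, the bound is 30 D +
  42 (S - D): the initial energy plus the accumulated excess. The subtracted term is what makes the
  induction close. A bound by a multiple of S alone would require the child off the edge to control
  the increment, and f may be constant on that child.\<close>

lemma sum_dyadic_sum_edge_le: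
  assumes "i < j" "j \<le> 2"
  shows "(\<Sum>n\<le>N. (5/3)^n * dyadic_sum n (edge_fun f w i j))
    \<le> 42 * subcell_energy f N w - 12 * cell_energy f w"
proof (induction N arbitrary: w)
  case 0
  have "(i, j) \<in> {(0,1), (0,2), (1,2)}"
    using assms by auto
  then have "(f (Phiw w (q j)) - f (Phiw w (q i)))\<^sup>2 \<le> cell_energy f w"
    by (auto simp: cell_energy_def power2_commute)
  with cell_energy_nonneg[of f w] show ?case
    by (simp add: dyadic_sum_0 edge_fun_0 edge_fun_1 subcell_energy_0)
next
  case (Suc N)
  define k where "k = 3 - i - j"
  have ijk: "(i, j, k) \<in> {(0,1,2), (0,2,1), (1,2,0)}"
    using assms by (auto simp: k_def)
  let ?Q = "\<lambda>N w. \<Sum>n\<le>N. (5/3)^n * dyadic_sum n (edge_fun f w i j)"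
  have "?Q (Suc N) w = (f (Phiw w (q j)) - f (Phiw w (q i)))\<^sup>2
      + (\<Sum>n\<le>N. (5/3)^Suc n * dyadic_sum (Suc n) (edge_fun f w i j))"
    unfolding sum.atMost_Suc_shift by (simp add: dyadic_sum_0 edge_fun_0 edge_fun_1)
  also have "(\<Sum>n\<le>N. (5/3)^Suc n * dyadic_sum (Suc n) (edge_fun f w i j))
     = 5/3 * (?Q N (w @ [i]) + ?Q N (w @ [j]))"
    unfolding dyadic_sum_Suc edge_fun_right unfolding edge_fun_left
    by (simp add: sum_distrib_left sum.distrib distrib_left mult.assoc)
  finally have "?Q (Suc N) w = (f (Phiw w (q j)) - f (Phiw w (q i)))\<^sup>2 + 5/3 * (?Q N (w @ [i]) + ?Q N (w @ [j]))" .
  moreover have "subcell_energy f (Suc N) w = 5/3 * (subcell_energy f N (w @ [i]) + subcell_energy f N (w @ [j])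
     + subcell_energy f N (w @ [k]))"
    using ijk unfolding subcell_energy_Suc by auto
  \<comment> \<open>The induction hypothesis is spent on the two children along the edge. Of the
    third child only the lower bound of its subcell energy by its cell energy enters.\<close>
  ultimately show ?case
    using Suc[of "w @ [i]"] Suc[of "w @ [j]"] edge_children_cell_energy_le[OF ijk, of f w]
      cell_energy_le_subcell_energy[of f "w @ [k]" N]
    by argo
qed

section \<open>The Besov seminorm on an interval\<close>

definition besov_on :: "real set \<Rightarrow> (real \<Rightarrow> real) \<Rightarrow> ennreal" where
  "besov_on A g = (\<integral>\<^sup>+ x. \<integral>\<^sup>+ y. indicator A x * indicator A y *
     ennreal ((g x - g y)\<^sup>2 / \<bar>x - y\<bar> powr (1 + 2 * beta)) \<partial>lborel \<partial>lborel)"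

text \<open>20/3 is 4 times 5/3: halving the interval divides the area of the square of integration
  by 4, and the energy factor 5/3 remains.\<close>

lemma two_powr_beta: "2 powr (1 + 2 * beta) = 20/3"
proof -
  have "ln (4::real) = 2 * ln 2" using ln_realpow[of 2 2] by simp
  then have "1 + 2 * beta = 2 + ln (5/3) / ln 2" by (simp add: beta_def field_simps)
  then have "2 powr (1 + 2 * beta) = 4 * 2 powr (ln (5/3) / ln 2)" by (simp add: powr_add)
  also have "2 powr (ln (5/3) / ln 2) = (5/3::real)" by (simp add: powr_def)
  finally show ?thesis by simp
qed

lemma beta_pos: "0 < beta"
  by (simp add: beta_def add_pos_pos)

lemma two_power_powr_beta: "(2 ^ n) powr (1 + 2 * beta) = (20/3) ^ n"
proof -
  have "(2 ^ n) powr (1 + 2 * beta) = (2 powr (1 + 2 * beta)) powr real n"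
    by (simp add: powr_realpow[symmetric] powr_powr mult.commute)
  also have "\<dots> = (20/3) ^ n" unfolding two_powr_beta by (simp add: powr_realpow)
  finally show ?thesis .
qed

lemma besov_on_cong: "(\<And>x. x \<in> A \<Longrightarrow> g x = h x) \<Longrightarrow> besov_on A g = besov_on A h"
  unfolding besov_on_def by (intro nn_integral_cong) (auto simp: indicator_def)

lemma besov_on_mono: "A \<subseteq> B \<Longrightarrow> besov_on A g \<le> besov_on B g"
  unfolding besov_on_def by (intro nn_integral_mono) (auto simp: indicator_def)

lemma besov_on_affine:
  assumes L: "L > 0" and g [measurable]: "g \<in> borel_measurable borel"
  shows "besov_on {a..a+L} g
    = ennreal (L\<^sup>2 / L powr (1 + 2 * beta)) * besov_on {0..1} (\<lambda>t. g (a + L * t))"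
proof -
  let ?s = "1 + 2 * beta"
  let ?A = "{a..a+L}"
  let ?k = "\<lambda>x y. indicator ?A x * indicator ?A y * ennreal ((g x - g y)\<^sup>2 / \<bar>x - y\<bar> powr ?s)"
  let ?h = "\<lambda>x y. indicator {0..1} x * indicator {0..1} y *
    ennreal ((g (a + L * x) - g (a + L * y))\<^sup>2 / \<bar>x - y\<bar> powr ?s)"
  have ind: "indicator ?A (a + L * x) = (indicator {0..1} x :: ennreal)" for x
    using L by (auto simp: indicator_def mult_le_cancel_left1 zero_le_mult_iff)
  have k: "?k (a + L * x) (a + L * y) = ennreal (1 / L powr ?s) * ?h x y" for x y
  proof -
    have "\<bar>(a + L * x) - (a + L * y)\<bar> = L * \<bar>x - y\<bar>"
      using L by (simp add: abs_mult flip: right_diff_distrib)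
    then have "\<bar>(a + L * x) - (a + L * y)\<bar> powr ?s = L powr ?s * \<bar>x - y\<bar> powr ?s"
      using L by (simp add: powr_mult)
    then show ?thesis
      by (simp add: ind mult_ac flip: ennreal_mult)
  qed
  have "besov_on ?A g = (\<integral>\<^sup>+ x. ennreal L * (\<integral>\<^sup>+ y. ?k x (a + L * y) \<partial>lborel) \<partial>lborel)"
    unfolding besov_on_def
    by (intro nn_integral_cong, subst nn_integral_real_affine[where c = L and t = a]) (use L in auto)
  also have "\<dots> = ennreal L * (\<integral>\<^sup>+ x. ennreal L * (\<integral>\<^sup>+ y. ?k (a + L * x) (a + L * y) \<partial>lborel) \<partial>lborel)"
    by (subst nn_integral_real_affine[where c = L and t = a]) (use L in auto)
  also have "\<dots> = ennreal L * (\<integral>\<^sup>+ x. ennreal L * (ennreal (1 / L powr ?s) * (\<integral>\<^sup>+ y. ?h x y \<partial>lborel)) \<partial>lborel)"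
    unfolding k by (simp add: nn_integral_cmult)
  also have "\<dots> = ennreal L * (ennreal L * (ennreal (1 / L powr ?s) * besov_on {0..1} (\<lambda>t. g (a + L * t))))"
    unfolding besov_on_def by (simp add: nn_integral_cmult)
  also have "ennreal L * (ennreal L * (ennreal (1 / L powr ?s) * z)) = ennreal (L\<^sup>2 / L powr ?s) * z" for z
    using L by (simp add: mult.assoc[symmetric] ennreal_mult[symmetric] power2_eq_square)
  finally show ?thesis .
qed

lemma besov_on_affine_dyadic:
  assumes "g \<in> borel_measurable borel"
  shows "besov_on {a..a + 1/2^m} g = ennreal ((5/3) ^ m) * besov_on {0..1} (\<lambda>t. g (a + t / 2^m))"
proof -
  have "(1/2^m)\<^sup>2 / (1/2^m) powr (1 + 2 * beta) = (20/3)^m / (4::real)^m"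
    by (simp add: powr_divide two_power_powr_beta power2_eq_square flip: power_mult_distrib)
  also have "\<dots> = (5/3)^m" by (simp flip: power_divide)
  finally show ?thesis
    using besov_on_affine[of "1/2^m" g a] assms by simp
qed

text \<open>Dropping all pairs outside the chosen half loses nothing essential: after rescaling the
  half to unit length a factor 3/5 is gained, and this geometric decay drives the approach to an
  endpoint. The half is the one next to \<open>e\<close>.\<close>

lemma besov_on_half:
  assumes g: "g \<in> borel_measurable borel" and e: "e \<in> {0, 1}"
    and M: "besov_on {0..1} g \<le> ennreal M" "0 \<le> M"
  shows "besov_on {0..1} (\<lambda>t. g ((e + t) / 2)) \<le> ennreal (3/5 * M)"
proof -
  let ?B = "besov_on {0..1} (\<lambda>t. g ((e + t) / 2))"
  have "ennreal (5/3) * ?B = besov_on {e/2..e/2 + 1/2} g"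
    using besov_on_affine_dyadic[OF g, of "e/2" 1] by (simp add: add_divide_distrib)
  also have "\<dots> \<le> besov_on {0..1} g"
    using e by (intro besov_on_mono) auto
  finally have "ennreal (5/3) * ?B \<le> ennreal M" using M by simp
  then have "ennreal (3/5) * (ennreal (5/3) * ?B) \<le> ennreal (3/5) * ennreal M"
    by (rule mult_left_mono) simp
  then show ?thesis
    using M(2) by (simp add: mult.assoc[symmetric] flip: ennreal_mult)
qed

section \<open>Averages and endpoint values\<close>

abbreviation mean :: "(real \<Rightarrow> real) \<Rightarrow> real" where
  "mean g \<equiv> integral {0..1} g"

lemma cont_comp_affine:
  fixes g :: "real \<Rightarrow> real"
  assumes "continuous_on UNIV g"
  shows "continuous_on A (\<lambda>t. g (a + b * t))"
  by (rule continuous_on_compose2[OF assms]) (auto intro!: continuous_intros)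

lemma nn_integral_continuous_unit:
  fixes h :: "real \<Rightarrow> real"
  assumes "continuous_on {0..1} h" "\<And>x. x \<in> {0..1} \<Longrightarrow> 0 \<le> h x"
  shows "(\<integral>\<^sup>+ x. indicator {0..1} x * ennreal (h x) \<partial>lborel) = ennreal (mean h)"
proof -
  have "(h has_integral mean h) {0..1}"
    using assms(1) by (intro integrable_integral integrable_continuous_interval)
  from nn_integral_has_integral_lebesgue[OF assms(2) this]
  have "(\<integral>\<^sup>+ x. ennreal (indicator {0..1} x * h x) \<partial>lborel) = ennreal (mean h)" by simp
  moreover have "ennreal (indicator {0..1} x * h x) = indicator {0..1} x * ennreal (h x)" for x
    by (simp add: indicator_def)
  ultimately show ?thesis by simp
qed

lemma mean_square:
  assumes g: "continuous_on UNIV g"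
  shows "(mean g)\<^sup>2 \<le> mean (\<lambda>x. (g x)\<^sup>2)"
    and "mean (\<lambda>y. (c - g y)\<^sup>2) = c\<^sup>2 - 2 * c * mean g + mean (\<lambda>x. (g x)\<^sup>2)"
proof -
  note gi = continuous_on_subset[OF g subset_UNIV]
  have i1: "g integrable_on {0..1}" and i2: "(\<lambda>x. (g x)\<^sup>2) integrable_on {0..1}"
    by (auto intro!: integrable_continuous_interval continuous_intros gi)
  show *: "mean (\<lambda>y. (c - g y)\<^sup>2) = c\<^sup>2 - 2 * c * mean g + mean (\<lambda>x. (g x)\<^sup>2)" for c
  proof -
    have "((\<lambda>y. c\<^sup>2 - (2 * c) * g y + (g y)\<^sup>2) has_integral c\<^sup>2 - (2 * c) * mean g + mean (\<lambda>x. (g x)\<^sup>2)) {0..1}"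
      using has_integral_const_real[of "c\<^sup>2" 0 1]
      by (intro has_integral_add has_integral_diff has_integral_mult_right integrable_integral i1 i2) simp
    then show ?thesis
      by (intro integral_unique) (simp add: power2_diff algebra_simps)
  qed
  have "0 \<le> mean (\<lambda>y. (mean g - g y)\<^sup>2)"
    by (intro integral_nonneg integrable_continuous_interval continuous_intros gi) simp
  then show "(mean g)\<^sup>2 \<le> mean (\<lambda>x. (g x)\<^sup>2)"
    unfolding * by (simp add: power2_eq_square)
qed

text \<open>On the unit interval |x - y| \<le> 1, so the kernel is at least 1 off the diagonal. The
  double integral of the squared differences is twice the variance.\<close>

lemma variance_le_besov:
  assumes g: "continuous_on UNIV g"
  shows "ennreal (2 * (mean (\<lambda>x. (g x)\<^sup>2) - (mean g)\<^sup>2)) \<le> besov_on {0..1} g"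
proof -
  note gi = continuous_on_subset[OF g subset_UNIV]
  let ?I = "\<lambda>x. (g x)\<^sup>2 - 2 * g x * mean g + mean (\<lambda>x. (g x)\<^sup>2)"
  have I: "?I x = mean (\<lambda>y. (g x - g y)\<^sup>2)" for x
    using mean_square(2)[OF g, of "g x"] by simp
  have I_nonneg: "0 \<le> ?I x" for x
    unfolding I by (intro integral_nonneg integrable_continuous_interval continuous_intros gi) simp
  have "mean ?I = 2 * (mean (\<lambda>x. (g x)\<^sup>2) - (mean g)\<^sup>2)"
  proof (rule integral_unique)
    have "((\<lambda>x. (g x)\<^sup>2 - (2 * mean g) * g x + mean (\<lambda>x. (g x)\<^sup>2)) has_integral
       mean (\<lambda>x. (g x)\<^sup>2) - (2 * mean g) * mean g + mean (\<lambda>x. (g x)\<^sup>2)) {0..1}"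
      using has_integral_const_real[of "mean (\<lambda>x. (g x)\<^sup>2)" 0 1]
      by (intro has_integral_add has_integral_diff has_integral_mult_right integrable_integral)
        (auto intro!: integrable_continuous_interval continuous_intros gi)
    then show "(?I has_integral 2 * (mean (\<lambda>x. (g x)\<^sup>2) - (mean g)\<^sup>2)) {0..1}"
      by (simp add: power2_eq_square algebra_simps)
  qed
  then have "ennreal (2 * (mean (\<lambda>x. (g x)\<^sup>2) - (mean g)\<^sup>2))
      = (\<integral>\<^sup>+ x. indicator {0..1} x * ennreal (?I x) \<partial>lborel)"
    using I_nonneg by (subst nn_integral_continuous_unit) (auto intro!: continuous_intros gi)
  also have "\<dots> \<le> besov_on {0..1} g"
    unfolding besov_on_def
  proof (rule nn_integral_mono)
    fix x :: real
    show "indicator {0..1} x * ennreal (?I x) \<le> (\<integral>\<^sup>+ y. indicator {0..1} x * indicator {0..1} y *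
        ennreal ((g x - g y)\<^sup>2 / \<bar>x - y\<bar> powr (1 + 2 * beta)) \<partial>lborel)"
    proof (cases "x \<in> {0..1}")
      case True
      have "ennreal (?I x) = (\<integral>\<^sup>+ y. indicator {0..1} y * ennreal ((g x - g y)\<^sup>2) \<partial>lborel)"
        unfolding I by (subst nn_integral_continuous_unit) (auto intro!: continuous_intros gi)
      also have "\<dots> \<le> (\<integral>\<^sup>+ y. indicator {0..1} x * indicator {0..1} y *
        ennreal ((g x - g y)\<^sup>2 / \<bar>x - y\<bar> powr (1 + 2 * beta)) \<partial>lborel)"
      proof (rule nn_integral_mono)
        fix y :: real
        have "(g x - g y)\<^sup>2 \<le> (g x - g y)\<^sup>2 / \<bar>x - y\<bar> powr (1 + 2 * beta)"
          if "y \<in> {0..1}"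
        proof (cases "x = y")
          case False
          have "\<bar>x - y\<bar> powr (1 + 2 * beta) \<le> 1"
            using that True beta_pos by (intro powr_le1) auto
          with False show ?thesis
            by (simp add: le_divide_eq mult_left_le)
        qed simp
        with True show "indicator {0..1} y * ennreal ((g x - g y)\<^sup>2) \<le> indicator {0..1} x * indicator {0..1} y *
           ennreal ((g x - g y)\<^sup>2 / \<bar>x - y\<bar> powr (1 + 2 * beta))"
          by (auto simp: indicator_def intro!: ennreal_leI)
      qed
      finally show ?thesis using True by simp
    qed simp
  qed
  finally show ?thesis .
qed

lemma mean_halves:
  assumes g: "continuous_on UNIV g"
  shows "mean g = (mean (\<lambda>t. g ((0 + t) / 2)) + mean (\<lambda>t. g ((1 + t) / 2))) / 2"
proof -
  have i: "(g has_integral integral {a..b} g) {a..b}" for a b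
    by (intro integrable_integral integrable_continuous_interval continuous_on_subset[OF g subset_UNIV])
  have "((\<lambda>t. g ((0 + t) / 2)) has_integral 2 * integral {0..1/2} g) {0..1}"
    using has_integral_affinity'[of g "integral {0..1/2} g" 0 "1/2" "1/2" 0] i[of 0 "1/2"]
    by (simp add: mult.commute)
  moreover have "((\<lambda>t. g ((1 + t) / 2)) has_integral 2 * integral {1/2..1} g) {0..1}"
    using has_integral_affinity'[of g "integral {1/2..1} g" "1/2" 1 "1/2" "1/2"] i[of "1/2" 1]
    by (simp add: add_divide_distrib add.commute mult.commute)
  moreover have "integral {0..1/2} g + integral {1/2..1} g = mean g"
    using i[of 0 1] by (intro Henstock_Kurzweil_Integration.integral_combine) (auto simp: has_integral_iff)
  ultimately show ?thesis
    by (simp add: integral_unique)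
qed

text \<open>With a, b the means over the two halves, the left side is ((a - b)/2)^2. This is the
  variance of the function equal to a and b on the halves, hence at most the variance of
  \<open>g\<close>.\<close>

lemma mean_half_diff:
  assumes g: "continuous_on UNIV g" and e: "e \<in> {0, 1}"
    and M: "besov_on {0..1} g \<le> ennreal M" "0 \<le> M"
  shows "(mean g - mean (\<lambda>t. g ((e + t) / 2)))\<^sup>2 \<le> M / 2"
proof -
  let ?a = "mean (\<lambda>t. g ((0 + t) / 2))" and ?b = "mean (\<lambda>t. g ((1 + t) / 2))"
  have c: "continuous_on UNIV (\<lambda>t. g ((e + t) / 2))" for e
    using cont_comp_affine[OF g, of UNIV "e/2" "1/2"] by (simp add: add_divide_distrib)
  have "continuous_on UNIV (\<lambda>x. (g x)\<^sup>2)" using g by (intro continuous_intros)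
  from mean_halves[OF this]
  have "(?a\<^sup>2 + ?b\<^sup>2) / 2 \<le> mean (\<lambda>x. (g x)\<^sup>2)"
    using mean_square(1)[OF c, of 0] mean_square(1)[OF c, of 1] by simp
  moreover have "2 * (mean (\<lambda>x. (g x)\<^sup>2) - ((?a + ?b) / 2)\<^sup>2) \<le> M"
    using order_trans[OF variance_le_besov[OF g] M(1)] M(2)
    by (simp only: mean_halves[OF g, symmetric] ennreal_le_iff)
  moreover have "(mean g - mean (\<lambda>t. g ((e + t) / 2)))\<^sup>2 = (?a\<^sup>2 + ?b\<^sup>2) / 2 - ((?a + ?b) / 2)\<^sup>2"
    using e unfolding mean_halves[OF g] by (auto simp: power2_eq_square field_simps)
  ultimately show ?thesis by argo
qed

text \<open>The weights suit chains whose terms decay by 3/5: since 4/3 * 3/5 = 4/5 < 1, repeated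
  use stays bounded, whereas the weight 2 on the tail would give 6/5. It serves both the zoom
  towards an endpoint and the descent through cells.\<close>

lemma power2_add_le_weighted:
  fixes a b :: real
  shows "(a + b)\<^sup>2 \<le> 4 * a\<^sup>2 + 4/3 * b\<^sup>2"
proof -
  have "4 * a\<^sup>2 + 4/3 * b\<^sup>2 - (a + b)\<^sup>2 = (3 * a - b)\<^sup>2 / 3"
    by (simp add: power2_eq_square field_simps)
  also have "\<dots> \<ge> 0" by simp
  finally show ?thesis by simp
qed

text \<open>The interval shrinks to its endpoint \<open>e\<close> by halving. The constant solves C
  = 4 * 1/2 + (4/3) * (3/5) * C, that is C = 10.\<close>

lemma mean_zoom_diff:
  assumes "continuous_on UNIV g" and e: "e \<in> {0, 1}"
    and "besov_on {0..1} g \<le> ennreal M" "0 \<le> M"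
  shows "(mean g - mean (\<lambda>t. g (e + (t - e) / 2^n)))\<^sup>2 \<le> 10 * M"
  using assms(1,3,4)
proof (induction n arbitrary: g M)
  case (Suc n)
  let ?h = "\<lambda>t. g ((e + t) / 2)"
  have h: "continuous_on UNIV ?h"
    using cont_comp_affine[OF Suc.prems(1), of UNIV "e/2" "1/2"] by (simp add: add_divide_distrib)
  have "besov_on {0..1} ?h \<le> ennreal (3/5 * M)"
    using Suc.prems e by (intro besov_on_half) (auto intro: borel_measurable_continuous_onI)
  from Suc.IH[OF h this] Suc.prems
  have "(mean ?h - mean (\<lambda>t. ?h (e + (t - e) / 2^n)))\<^sup>2 \<le> 6 * M" by simp
  moreover have "(\<lambda>t. ?h (e + (t - e) / 2^n)) = (\<lambda>t. g (e + (t - e) / 2^Suc n))"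
    by (simp add: fun_eq_iff field_simps)
  moreover have "(mean g - mean ?h)\<^sup>2 \<le> M / 2"
    using Suc.prems e by (intro mean_half_diff)
  ultimately show ?case
    using power2_add_le_weighted[of "mean g - mean ?h" "mean ?h - mean (\<lambda>t. g (e + (t - e) / 2^Suc n))"]
    by simp
qed simp

lemma mean_endpoint_diff:
  assumes g: "continuous_on UNIV g" and e: "e \<in> {0, 1}"
    and M: "besov_on {0..1} g \<le> ennreal M" "0 \<le> M"
  shows "(mean g - g e)\<^sup>2 \<le> 10 * M"
proof (rule LIMSEQ_le_const2)
  have "(\<lambda>n. mean (\<lambda>t. g (e + (t - e) / 2^n))) \<longlonglongrightarrow> g e"
  proof (rule LIMSEQ_I)
    fix r :: real assume r: "r > 0"
    have "isCont g e" using g by (simp add: continuous_on_eq_continuous_at)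
    then obtain d where d: "d > 0" "\<And>x. \<bar>x - e\<bar> < d \<Longrightarrow> \<bar>g x - g e\<bar> < r / 2"
      using r unfolding continuous_at_eps_delta dist_real_def by (meson half_gt_zero)
    obtain N where N: "(1/2)^N < d" using real_arch_pow_inv[OF d(1), of "1/2"] by auto
    have "norm (mean (\<lambda>t. g (e + (t - e) / 2^n)) - g e) < r" if "n \<ge> N" for n
    proof -
      have c: "continuous_on {0..1} (\<lambda>t. g (e + (t - e) / 2^n))"
        using cont_comp_affine[OF g, of "{0..1}" "e - e/2^n" "1/2^n"] by (simp add: diff_divide_distrib algebra_simps)
      have "norm (integral {0..1} (\<lambda>t. g (e + (t - e) / 2^n) - g e)) \<le> r / 2 * (1 - 0)"
      proof (rule integral_bound)
        show "continuous_on {0..1} (\<lambda>t. g (e + (t - e) / 2^n) - g e)"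
          by (intro continuous_intros c)
        fix t :: real assume t: "t \<in> {0..1}"
        have "\<bar>(t - e) / 2^n\<bar> \<le> (1/2)^n"
          using t e by (auto simp: abs_divide power_one_over divide_le_cancel)
        also have "\<dots> \<le> (1/2)^N" using that by (intro power_decreasing) auto
        finally show "norm (g (e + (t - e) / 2^n) - g e) \<le> r / 2"
          using d(2)[of "e + (t - e) / 2^n"] N by simp
      qed simp
      also have "integral {0..1} (\<lambda>t. g (e + (t - e) / 2^n) - g e) = mean (\<lambda>t. g (e + (t - e) / 2^n)) - g e"
        using c by (subst integral_diff) (auto intro!: integrable_continuous_interval)
      finally show ?thesis using r by simp
    qed
    then show "\<exists>N. \<forall>n\<ge>N. norm (mean (\<lambda>t. g (e + (t - e) / 2^n)) - g e) < r" by blast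
  qed
  then show "(\<lambda>n. (mean g - mean (\<lambda>t. g (e + (t - e) / 2^n)))\<^sup>2) \<longlonglongrightarrow> (mean g - g e)\<^sup>2"
    by (intro tendsto_intros)
qed (use mean_zoom_diff[OF assms] in blast)

text \<open>Both ends are compared with the mean over the whole interval, whence 40 = 2 * 10 + 2 *
  10.\<close>

lemma endpoint_diff_le_besov:
  assumes g: "continuous_on UNIV g" and M: "besov_on {0..1} g \<le> ennreal M" "0 \<le> M"
  shows "(g 1 - g 0)\<^sup>2 \<le> 40 * M"
proof -
  have "(mean g - g 0)\<^sup>2 \<le> 10 * M" "(mean g - g 1)\<^sup>2 \<le> 10 * M"
    using assms by (auto intro!: mean_endpoint_diff)
  moreover have "(g 1 - g 0)\<^sup>2 \<le> 2 * (mean g - g 0)\<^sup>2 + 2 * (mean g - g 1)\<^sup>2"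
    using sum_squares_bound[of "mean g - g 0" "g 1 - mean g"] by (simp add: power2_eq_square algebra_simps)
  ultimately show ?thesis by simp
qed

section \<open>Dyadic upper bound for the Besov seminorm\<close>

definition dyadic_index :: "nat \<Rightarrow> real \<Rightarrow> nat" where
  "dyadic_index n x = nat \<lfloor>2 ^ n * x\<rfloor>"

definition dyadic_floor :: "nat \<Rightarrow> real \<Rightarrow> real" where
  "dyadic_floor n x = real (dyadic_index n x) / 2 ^ n"

text \<open>At \<open>k = 0\<close> the truncated \<open>k - 1\<close> makes the increment vanish.\<close>
definition back_incr :: "(real \<Rightarrow> real) \<Rightarrow> nat \<Rightarrow> nat \<Rightarrow> real" where
  "back_incr g n k = (g (real k / 2^n) - g (real (k - 1) / 2^n))\<^sup>2"

lemma back_incr_nonneg [simp]: "0 \<le> back_incr g n k"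
  by (simp add: back_incr_def)

lemma dyadic_index_bounds:
  assumes "0 \<le> x"
  shows "real (dyadic_index n x) / 2^n \<le> x" "x < real (dyadic_index n x) / 2^n + 1/2^n"
proof -
  have "real (dyadic_index n x) = of_int \<lfloor>2 ^ n * x\<rfloor>"
    using assms by (simp add: dyadic_index_def)
  then have "real (dyadic_index n x) \<le> 2^n * x" "2^n * x < real (dyadic_index n x) + 1"
    by linarith+
  then show "real (dyadic_index n x) / 2^n \<le> x" "x < real (dyadic_index n x) / 2^n + 1/2^n"
    by (simp_all add: field_simps)
qed

lemma dyadic_floor_tendsto:
  assumes "0 \<le> x"
  shows "(\<lambda>n. dyadic_floor n x) \<longlonglongrightarrow> x"
proof (rule tendsto_sandwich)
  show "\<forall>\<^sub>F n in sequentially. x - (1/2)^n \<le> dyadic_floor n x"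
    using dyadic_index_bounds(2)[OF assms]
    by (intro always_eventually) (simp add: dyadic_floor_def power_one_over less_imp_le diff_le_eq)
  show "\<forall>\<^sub>F n in sequentially. dyadic_floor n x \<le> x"
    using dyadic_index_bounds(1)[OF assms] by (intro always_eventually) (simp add: dyadic_floor_def)
  show "(\<lambda>n. x - (1/2)^n) \<longlonglongrightarrow> x"
    using tendsto_diff[OF tendsto_const LIMSEQ_power_zero[of "1/2::real"], of x] by simp
qed simp

lemma dyadic_index_half: "0 \<le> x \<Longrightarrow> dyadic_index n x = dyadic_index (Suc n) x div 2"
proof -
  assume "0 \<le> x"
  have "\<lfloor>2 ^ n * x\<rfloor> = \<lfloor>2 ^ Suc n * x / of_int 2\<rfloor>" by simp
  also have "\<dots> = \<lfloor>2 ^ Suc n * x\<rfloor> div 2" by (rule floor_divide_real_eq_div) simp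
  finally show ?thesis
    using nat_div_distrib[of "\<lfloor>2 ^ Suc n * x\<rfloor>" 2] \<open>0 \<le> x\<close>
    unfolding dyadic_index_def by (simp del: power_Suc)
qed

text \<open>Passing to the finer grid moves the left dyadic neighbour of x either not at all or by
  one fine step to the right. That step ends at the new neighbour, so it is the backward increment
  there.\<close>

lemma dyadic_floor_step:
  assumes "0 \<le> x"
  shows "(g (dyadic_floor (Suc n) x) - g (dyadic_floor n x))\<^sup>2
    \<le> back_incr g (Suc n) (dyadic_index (Suc n) x)"
proof -
  define K where "K = dyadic_index (Suc n) x"
  have n: "dyadic_floor n x = real (K div 2) / 2^n"
    unfolding dyadic_floor_def K_def dyadic_index_half[OF assms, of n] ..
  have S: "dyadic_floor (Suc n) x = real K / 2^Suc n" by (simp add: dyadic_floor_def K_def)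
  show ?thesis
  proof (cases "even K")
    case True
    then obtain j where j: "K = 2 * j" by (rule evenE)
    have "dyadic_floor (Suc n) x = dyadic_floor n x"
      unfolding n S j by simp
    then show ?thesis by (simp add: back_incr_def)
  next
    case False
    then obtain j where j: "K = 2 * j + 1" by (rule oddE)
    have "dyadic_floor n x = real (K - 1) / 2^Suc n"
      unfolding n j by simp
    then show ?thesis unfolding back_incr_def S K_def[symmetric] by simp
  qed
qed

lemma power2_add_le: "(a + b)\<^sup>2 \<le> 2 * a\<^sup>2 + 2 * (b::real)\<^sup>2"
  using sum_squares_bound[of a b] by (simp add: power2_eq_square algebra_simps)

text \<open>The increment at level n on the left strengthens the induction: it pays for the step
  from level n - 1 to n. The crude doubling 2^j is affordable because averaging level n + j
  increments over the interval gains 2^-(n+j).\<close>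

lemma dyadic_floor_chain:
  assumes x: "0 \<le> x"
  shows "(g (dyadic_floor (n + J) x) - g (dyadic_floor n x))\<^sup>2 + back_incr g n (dyadic_index n x)
    \<le> (\<Sum>j\<le>J. 2^j * back_incr g (n + j) (dyadic_index (n + j) x))"
proof (induction J arbitrary: n)
  case (Suc J)
  let ?d = "\<lambda>n. g (dyadic_floor n x)" and ?b = "\<lambda>n. back_incr g n (dyadic_index n x)"
  have "(?d (n + Suc J) - ?d n)\<^sup>2 \<le> 2 * (?d (Suc n + J) - ?d (Suc n))\<^sup>2 + 2 * (?d (Suc n) - ?d n)\<^sup>2"
    using power2_add_le[of "?d (Suc n + J) - ?d (Suc n)" "?d (Suc n) - ?d n"] by simp
  also have "\<dots> \<le> 2 * (\<Sum>j\<le>J. 2^j * ?b (Suc n + j))"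
    using Suc[of "Suc n"] dyadic_floor_step[OF x, of g n] by argo
  finally show ?case
    unfolding sum.atMost_Suc_shift by (simp add: sum_distrib_left mult.assoc)
qed simp

text \<open>The indices of the two points differ by at most one, so the larger of the two points has
  the increment as its backward one.\<close>

lemma dyadic_floor_close:
  assumes x: "0 \<le> x" and y: "0 \<le> y" and xy: "\<bar>x - y\<bar> \<le> 1 / 2^n"
  shows "(g (dyadic_floor n x) - g (dyadic_floor n y))\<^sup>2
    \<le> back_incr g n (dyadic_index n x) + back_incr g n (dyadic_index n y)"
proof -
  have *: "(g (dyadic_floor n x) - g (dyadic_floor n y))\<^sup>2 \<le> back_incr g n (dyadic_index n y)"
    if "0 \<le> x" "x \<le> y" "\<bar>x - y\<bar> \<le> 1 / 2^n" for x y
  proof -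
    have "2^n * y \<le> 2^n * x + 1" using that by (simp add: field_simps)
    then have "dyadic_index n y \<le> dyadic_index n x + 1"
      using that unfolding dyadic_index_def by (simp add: nat_le_iff) linarith
    moreover have "dyadic_index n x \<le> dyadic_index n y"
      using that unfolding dyadic_index_def by (intro nat_mono floor_mono) simp
    ultimately consider "dyadic_index n y = dyadic_index n x" | "dyadic_index n x = dyadic_index n y - 1"
      by linarith
    then show ?thesis
      by cases (simp_all add: dyadic_floor_def back_incr_def power2_commute)
  qed
  show ?thesis
  proof (cases "x \<le> y")
    case True
    with *[OF x True xy] show ?thesis by (simp add: add_increasing)
  next
    case False
    then have "(g (dyadic_floor n y) - g (dyadic_floor n x))\<^sup>2 \<le> back_incr g n (dyadic_index n x)"
      using xy y by (intro *) (auto simp: abs_minus_commute)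
    then show ?thesis by (simp add: power2_commute add_increasing2)
  qed
qed

text \<open>A majorant depending on one point only. It separates the bound for a pair (x, y) into a
  part in x and a part in y, so each can be integrated over the other variable for free.\<close>

definition dyadic_osc :: "(real \<Rightarrow> real) \<Rightarrow> nat \<Rightarrow> real \<Rightarrow> ennreal" where
  "dyadic_osc g n x = (\<Sum>j. ennreal (2^j * back_incr g (n + j) (dyadic_index (n + j) x)))"

lemma diff_le_dyadic_osc:
  assumes g: "continuous_on UNIV g" and x: "0 \<le> x" and y: "0 \<le> y" and xy: "\<bar>x - y\<bar> \<le> 1 / 2^n"
  shows "ennreal ((g x - g y)\<^sup>2) \<le> 3 * (dyadic_osc g n x + dyadic_osc g n y)"
proof (rule LIMSEQ_le_const2)
  have "isCont g z" for z using g by (simp add: continuous_on_eq_continuous_at)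
  then have lim: "(\<lambda>J. g (dyadic_floor (n + J) z)) \<longlonglongrightarrow> g z" if "0 \<le> z" for z
    using LIMSEQ_ignore_initial_segment[OF dyadic_floor_tendsto[OF that], of n]
    by (intro isCont_tendsto_compose[where g = g]) (simp_all add: add.commute)
  show "(\<lambda>J. ennreal ((g (dyadic_floor (n + J) x) - g (dyadic_floor (n + J) y))\<^sup>2))
      \<longlonglongrightarrow> ennreal ((g x - g y)\<^sup>2)"
    by (intro tendsto_ennrealI tendsto_intros lim x y)
  have "ennreal ((g (dyadic_floor (n + J) x) - g (dyadic_floor (n + J) y))\<^sup>2)
      \<le> 3 * (dyadic_osc g n x + dyadic_osc g n y)" for J
  proof -
    let ?d = "\<lambda>n x. g (dyadic_floor n x)"
    let ?s = "\<lambda>x. \<Sum>j\<le>J. 2^j * back_incr g (n + j) (dyadic_index (n + j) x)"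
    have tri: "(a + b + c)\<^sup>2 \<le> 3 * (a\<^sup>2 + b\<^sup>2 + c\<^sup>2)" for a b c :: real
    proof -
      have "3 * (a\<^sup>2 + b\<^sup>2 + c\<^sup>2) - (a + b + c)\<^sup>2 = (a-b)\<^sup>2 + (b-c)\<^sup>2 + (a-c)\<^sup>2"
        by (simp add: power2_eq_square algebra_simps)
      also have "\<dots> \<ge> 0" by simp
      finally show ?thesis by simp
    qed
    have osc: "ennreal (?s z) \<le> dyadic_osc g n z" for z
    proof -
      have "ennreal (?s z) = (\<Sum>j\<le>J. ennreal (2^j * back_incr g (n + j) (dyadic_index (n + j) z)))"
        by (rule sum_ennreal[symmetric]) simp
      also have "\<dots> \<le> dyadic_osc g n z"
        unfolding dyadic_osc_def by (intro sum_le_suminf) auto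
      finally show ?thesis .
    qed
    have "(?d (n + J) x - ?d (n + J) y)\<^sup>2
        \<le> 3 * ((?d (n + J) x - ?d n x)\<^sup>2 + (?d n x - ?d n y)\<^sup>2 + (?d (n + J) y - ?d n y)\<^sup>2)"
      using tri[of "?d (n + J) x - ?d n x" "?d n x - ?d n y" "?d n y - ?d (n + J) y"]
      by (simp add: power2_commute[of "?d n y"])
    also have "\<dots> \<le> 3 * (?s x + ?s y)"
      using dyadic_floor_chain[OF x, of g n J] dyadic_floor_chain[OF y, of g n J]
        dyadic_floor_close[OF x y xy, of g] by argo
    finally have "ennreal ((?d (n + J) x - ?d (n + J) y)\<^sup>2) \<le> ennreal (3 * (?s x + ?s y))"
      by (rule ennreal_leI)
    also have "\<dots> = 3 * (ennreal (?s x) + ennreal (?s y))"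
      by (simp add: ennreal_mult ennreal_plus sum_nonneg back_incr_def)
    also have "\<dots> \<le> 3 * (dyadic_osc g n x + dyadic_osc g n y)"
      by (intro mult_left_mono add_mono osc) auto
    finally show ?thesis .
  qed
  then show "\<exists>N. \<forall>J\<ge>N. ennreal ((g (dyadic_floor (n + J) x) - g (dyadic_floor (n + J) y))\<^sup>2)
      \<le> 3 * (dyadic_osc g n x + dyadic_osc g n y)" by blast
qed

lemma measurable_dyadic_index [measurable]: "dyadic_index n \<in> borel \<rightarrow>\<^sub>M count_space UNIV"
  unfolding dyadic_index_def by measurable

lemma dyadic_index_le: "0 \<le> t \<Longrightarrow> t \<le> 1 \<Longrightarrow> dyadic_index n t \<le> 2^n"
proof -
  assume "0 \<le> t" "t \<le> 1"
  then have "2^n * t \<le> real (2^n)" by (simp add: mult_left_le)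
  then have "\<lfloor>2^n * t\<rfloor> \<le> int (2^n)" by linarith
  then show ?thesis by (simp add: dyadic_index_def nat_le_iff)
qed

text \<open>The points with index k lie in an interval of length 2^-n and carry the increment over
  the preceding interval. The shift by one costs nothing, since the increment at k = 0 is
  zero.\<close>

lemma nn_integral_back_incr_le:
  "(\<integral>\<^sup>+ x. indicator {0..1} x * ennreal (back_incr g n (dyadic_index n x)) \<partial>lborel)
     \<le> ennreal (dyadic_sum n g / 2^n)"
proof -
  let ?I = "\<lambda>k. {real k / 2^n .. real k / 2^n + 1/2^n}"
  \<comment> \<open>Index 2^n occurs only at x = 1, but keeping its whole interval supplies the last
    increment and makes the bound exactly the dyadic sum.\<close>
  have "indicator {0..1} x * ennreal (back_incr g n (dyadic_index n x))
      \<le> (\<Sum>k\<le>2^n. ennreal (back_incr g n k) * indicator (?I k) x)" for x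
  proof (cases "x \<in> {0..1}")
    case True
    let ?k = "dyadic_index n x"
    have k: "x \<in> ?I ?k" using dyadic_index_bounds[of x n] True by auto
    have "?k \<le> 2^n" using True by (intro dyadic_index_le) auto
    then have "ennreal (back_incr g n ?k) * indicator (?I ?k) x
       \<le> (\<Sum>k\<le>2^n. ennreal (back_incr g n k) * indicator (?I k) x)"
      by (intro member_le_sum) auto
    moreover have "indicator (?I ?k) x = (1::ennreal)" using k by (simp add: indicator_def)
    ultimately show ?thesis using True by simp
  qed simp
  then have "(\<integral>\<^sup>+ x. indicator {0..1} x * ennreal (back_incr g n (dyadic_index n x)) \<partial>lborel)
      \<le> (\<integral>\<^sup>+ x. (\<Sum>k\<le>2^n. ennreal (back_incr g n k) * indicator (?I k) x) \<partial>lborel)"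
    by (intro nn_integral_mono)
  also have "\<dots> = (\<Sum>k\<le>2^n. \<integral>\<^sup>+ x. ennreal (back_incr g n k) * indicator (?I k) x \<partial>lborel)"
    by (rule nn_integral_sum) simp
  also have "\<dots> = (\<Sum>k\<le>2^n. ennreal (back_incr g n k) * ennreal (1/2^n))"
    by (intro sum.cong refl, subst nn_integral_cmult_indicator) simp_all
  also have "\<dots> = ennreal (\<Sum>k\<le>2^n. back_incr g n k / 2^n)"
    by (simp add: back_incr_def flip: ennreal_mult)
  also have "(\<Sum>k\<le>2^n. back_incr g n k / 2^n) = dyadic_sum n g / 2^n"
  proof -
    have "(\<Sum>k\<le>2^n. back_incr g n k) = back_incr g n 0 + (\<Sum>k<2^n. back_incr g n (Suc k))"
      by (metis lessThan_Suc_atMost sum.lessThan_Suc_shift)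
    also have "\<dots> = dyadic_sum n g" by (simp add: back_incr_def dyadic_sum_def)
    finally show ?thesis by (simp flip: sum_divide_distrib)
  qed
  finally show ?thesis .
qed

lemma ex_dyadic_scale:
  assumes "0 < d" "d \<le> (1::real)"
  obtains n where "d \<le> 1/2^n" "1/2^Suc n < d"
proof -
  have "\<exists>n. (1/2::real)^n < d" by (rule real_arch_pow_inv) (use assms in auto)
  define n where "n = (LEAST n. (1/2::real)^n < d)"
  have n: "(1/2::real)^n < d" unfolding n_def by (rule LeastI_ex) fact
  with assms have "n \<noteq> 0" by (intro notI) simp
  then obtain m where m: "n = Suc m" by (cases n) auto
  have "\<not> (1/2::real)^m < d" using not_less_Least[of m "\<lambda>n. (1/2::real)^n < d"] m n_def by auto
  with n m show ?thesis by (intro that[of m]) (auto simp: power_one_over)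
qed

lemma besov_kernel_le:
  assumes "1/2^Suc n < \<bar>x - y\<bar>"
  shows "c\<^sup>2 / \<bar>x - y\<bar> powr (1 + 2 * beta) \<le> (20/3)^Suc n * c\<^sup>2"
proof -
  have "1 / (20/3)^Suc n = (1/2^Suc n) powr (1 + 2 * beta)"
    using two_power_powr_beta[of "Suc n"] by (simp add: powr_divide del: power_Suc)
  also have "\<dots> \<le> \<bar>x - y\<bar> powr (1 + 2 * beta)"
    using assms beta_pos by (intro powr_mono2) auto
  finally have "1 / (20/3)^Suc n \<le> \<bar>x - y\<bar> powr (1 + 2 * beta)" .
  moreover have "0 < 1 / (20/3::real)^Suc n" "0 < (1::real) / 2^Suc n" by simp_all
  ultimately have "c\<^sup>2 / \<bar>x - y\<bar> powr (1 + 2 * beta) \<le> c\<^sup>2 / (1 / (20/3)^Suc n)"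
    using assms by (intro divide_left_mono mult_pos_pos) (simp_all only: powr_gt_zero, simp_all)
  then show ?thesis by (simp add: mult.commute del: power_Suc)
qed

text \<open>Each pair is treated at the scale 2^-n of its distance and chained to dyadic points of
  levels n + j. Regrouped by the level n + j, the contributions carry the factor 40 (3/5)^j. The
  geometric series gives 100, and the symmetric part in y doubles it.\<close>

lemma besov_le_dyadic_sum:
  assumes g: "continuous_on UNIV g"
  shows "besov_on {0..1} g \<le> ennreal 200 * (\<Sum>n. ennreal ((5/3)^n * dyadic_sum n g))"
proof -
  let ?s = "1 + 2 * beta"
  define b where "b n x = ennreal (back_incr g n (dyadic_index n x))" for n x
  define u :: "real \<Rightarrow> ennreal" where "u = indicator {0..1}"
  \<comment> \<open>The band |x - y| \<le> 2^-n contains the pairs of scale n. Since y is not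
    confined to the unit interval, its integral is exactly 2/2^n.\<close>
  define K :: "nat \<Rightarrow> real \<Rightarrow> real \<Rightarrow> ennreal" where
    "K n x y = ennreal (3 * (20/3)^Suc n) * (u x * indicator {x - 1/2^n .. x + 1/2^n} y)" for n x y
  \<comment> \<open>Summing over all n avoids choosing the scale of (x, y) measurably. With j
    outside, the inner sum for fixed j becomes a tail of \<open>Z\<close>.\<close>
  define H where "H x y = (\<Sum>j. \<Sum>n. K n x y * (ennreal (2^j) * b (n + j) x))" for x y
  define Z where "Z = (\<Sum>n. ennreal ((5/3)^n * dyadic_sum n g))"
  have b_meas [measurable]: "b n \<in> borel_measurable borel" for n
    unfolding b_def by measurable
  have u_meas [measurable]: "u \<in> borel_measurable borel"
    unfolding u_def by measurable
  have K_meas [measurable]: "(\<lambda>z. K n (fst z) (snd z)) \<in> borel_measurable (borel \<Otimes>\<^sub>M borel)" for n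
  proof -
    have "(\<lambda>z::real \<times> real. indicator {z. fst z - 1/2^n \<le> snd z \<and> snd z \<le> fst z + 1/2^n} z :: ennreal)
        \<in> borel_measurable (borel \<Otimes>\<^sub>M borel)"
    proof (rule borel_measurable_indicator)
      have "{z \<in> space (borel \<Otimes>\<^sub>M borel). fst z - 1/2^n \<le> snd z \<and> snd z \<le> fst z + 1/2^n}
          \<in> sets (borel \<Otimes>\<^sub>M (borel :: real measure))"
        by measurable
      then show "{z::real \<times> real. fst z - 1/2^n \<le> snd z \<and> snd z \<le> fst z + 1/2^n} \<in> sets (borel \<Otimes>\<^sub>M borel)"
        by (simp add: space_pair_measure)
    qed
    moreover have "indicator {z. fst z - 1/2^n \<le> snd z \<and> snd z \<le> fst z + 1/2^n} z
       = (indicator {fst z - 1/2^n .. fst z + 1/2^n} (snd z) :: ennreal)" for z :: "real \<times> real"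
      by (simp add: indicator_def)
    ultimately show ?thesis
      unfolding K_def by simp
  qed
  have H_meas [measurable]: "(\<lambda>z. H (fst z) (snd z)) \<in> borel_measurable (borel \<Otimes>\<^sub>M borel)"
    unfolding H_def by measurable
  have H1 [measurable]: "(\<lambda>y. H x y) \<in> borel_measurable borel" for x
  proof -
    have "(\<lambda>y. H (fst (x, y)) (snd (x, y))) \<in> borel_measurable borel"
      by (rule measurable_compose[OF _ H_meas]) measurable
    then show ?thesis by simp
  qed
  have H2 [measurable]: "(\<lambda>y. H y x) \<in> borel_measurable borel" for x
  proof -
    have "(\<lambda>y. H (fst (y, x)) (snd (y, x))) \<in> borel_measurable borel"
      by (rule measurable_compose[OF _ H_meas]) measurable
    then show ?thesis by simp
  qed
  have H_swap: "(\<lambda>(x, y). H y x) \<in> borel_measurable (borel \<Otimes>\<^sub>M borel)"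
  proof -
    have "(\<lambda>z. H (fst (snd z, fst z)) (snd (snd z, fst z))) \<in> borel_measurable (borel \<Otimes>\<^sub>M borel)"
      by (rule measurable_compose[OF _ H_meas]) measurable
    then show ?thesis by (simp add: case_prod_beta')
  qed
  have H3 [measurable]: "(\<lambda>x. \<integral>\<^sup>+ y. H x y \<partial>lborel) \<in> borel_measurable borel"
    by (rule lborel.borel_measurable_nn_integral) (simp add: case_prod_beta' H_meas)
  have H4 [measurable]: "(\<lambda>x. \<integral>\<^sup>+ y. H y x \<partial>lborel) \<in> borel_measurable borel"
    by (rule lborel.borel_measurable_nn_integral)
      (subst measurable_cong_sets[OF sets_pair_measure_cong[OF refl sets_lborel] refl], rule H_swap)
  have pw: "indicator {0..1} x * indicator {0..1} y * ennreal ((g x - g y)\<^sup>2 / \<bar>x - y\<bar> powr ?s)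
      \<le> H x y + H y x" for x y
  proof (cases "x \<in> {0..1} \<and> y \<in> {0..1} \<and> x \<noteq> y")
    case True
    then have "0 < \<bar>x - y\<bar>" "\<bar>x - y\<bar> \<le> 1" by auto
    then obtain n where n: "\<bar>x - y\<bar> \<le> 1/2^n" "1/2^Suc n < \<bar>x - y\<bar>"
      by (rule ex_dyadic_scale)
    have osc: "ennreal (3 * (20/3)^Suc n) * dyadic_osc g n x \<le> H x y"
      if "x \<in> {0..1}" "\<bar>x - y\<bar> \<le> 1/2^n" for x y
    proof -
      have "ennreal (3 * (20/3)^Suc n) * dyadic_osc g n x = (\<Sum>j. K n x y * (ennreal (2^j) * b (n + j) x))"
        using that by (simp add: dyadic_osc_def K_def u_def b_def ennreal_mult abs_le_iff back_incr_def)
      also have "\<dots> \<le> H x y"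
        unfolding H_def
      proof (intro suminf_le summableI)
        fix j
        show "K n x y * (ennreal (2^j) * b (n + j) x) \<le> (\<Sum>n. K n x y * (ennreal (2^j) * b (n + j) x))"
          using sum_le_suminf[of "\<lambda>n. K n x y * (ennreal (2^j) * b (n + j) x)" "{n}"] by simp
      qed
      finally show ?thesis .
    qed
    have "ennreal ((g x - g y)\<^sup>2 / \<bar>x - y\<bar> powr ?s) \<le> ennreal ((20/3)^Suc n * (g x - g y)\<^sup>2)"
      by (intro ennreal_leI besov_kernel_le n)
    also have "\<dots> = ennreal ((20/3)^Suc n) * ennreal ((g x - g y)\<^sup>2)"
      by (rule ennreal_mult) auto
    also have "\<dots> \<le> ennreal ((20/3)^Suc n) * (3 * (dyadic_osc g n x + dyadic_osc g n y))"
      using True n by (intro mult_left_mono diff_le_dyadic_osc g) auto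
    also have "\<dots> = ennreal (3 * (20/3)^Suc n) * dyadic_osc g n x + ennreal (3 * (20/3)^Suc n) * dyadic_osc g n y"
      by (simp add: ennreal_mult distrib_left mult_ac del: power_Suc)
    also have "\<dots> \<le> H x y + H y x"
      using True n by (intro add_mono osc) (auto simp: abs_minus_commute)
    finally show ?thesis using True by simp
  qed (auto simp: indicator_def)
  have collect: "ennreal a * p * (ennreal c * r) * ennreal d = ennreal (a * c * d) * (p * r)"
    if "0 \<le> a" "0 \<le> c" "0 \<le> d" for a c d p r
    using that by (simp add: ennreal_mult mult_ac)
  \<comment> \<open>The constant is 3 * (20/3) * 2 = 40, and (20/3)^n / 2^n = (10/3)^n.\<close>
  have inner: "(\<integral>\<^sup>+ y. K n x y * (ennreal (2^j) * b (n + j) x) \<partial>lborel)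
       = ennreal (40 * (10/3)^n * 2^j) * (u x * b (n + j) x)" for n j x
    proof -
      have "(\<integral>\<^sup>+ y. K n x y * (ennreal (2^j) * b (n + j) x) \<partial>lborel)
          = (\<integral>\<^sup>+ y. (ennreal (3 * (20/3)^Suc n) * u x * (ennreal (2^j) * b (n + j) x)) *
              indicator {x - 1/2^n .. x + 1/2^n} y \<partial>lborel)"
        unfolding K_def by (simp add: mult_ac)
      also have "\<dots> = ennreal (3 * (20/3)^Suc n) * u x * (ennreal (2^j) * b (n + j) x) * ennreal (2/2^n)"
        by (subst nn_integral_cmult_indicator) auto
      also have "\<dots> = ennreal (3 * (20/3)^Suc n * 2^j * (2/2^n)) * (u x * b (n + j) x)"
        by (intro collect) auto
      also have "3 * (20/3)^Suc n * 2^j * (2/2^n) = 40 * (10/3)^n * (2::real)^j"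
        by (simp add: field_simps flip: power_mult_distrib)
      finally show ?thesis .
    qed
  have HK: "(\<integral>\<^sup>+ x. \<integral>\<^sup>+ y. K n x y * (ennreal (2^j) * b (n + j) x) \<partial>lborel \<partial>lborel)
      \<le> ennreal (40 * (3/5)^j) * ennreal ((5/3)^(n + j) * dyadic_sum (n + j) g)" for n j
  proof -
    have "(\<integral>\<^sup>+ x. \<integral>\<^sup>+ y. K n x y * (ennreal (2^j) * b (n + j) x) \<partial>lborel \<partial>lborel)
       = ennreal (40 * (10/3)^n * 2^j) * (\<integral>\<^sup>+ x. u x * b (n + j) x \<partial>lborel)"
      unfolding inner by (intro nn_integral_cmult) measurable
    also have "\<dots> \<le> ennreal (40 * (10/3)^n * 2^j) * ennreal (dyadic_sum (n + j) g / 2^(n + j))"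
      unfolding u_def b_def by (intro mult_left_mono nn_integral_back_incr_le) simp
    also have "\<dots> = ennreal (40 * (10/3)^n * 2^j * (dyadic_sum (n + j) g / 2^(n + j)))"
      by (rule ennreal_mult[symmetric]) (auto simp: dyadic_sum_nonneg)
    \<comment> \<open>The factors 2^n and 2^j cancel against the interval length. Moving from
      (5/3)^n to (5/3)^(n+j) leaves (3/5)^j.\<close>
    also have "40 * (10/3)^n * 2^j * (dyadic_sum (n + j) g / 2^(n + j))
        = 40 * (3/5)^j * ((5/3)^(n + j) * dyadic_sum (n + j) g)"
    proof -
      have "(10/3::real)^n = (5/3)^n * 2^n" "(3/5::real)^j * (5/3)^j = 1"
        by (simp_all flip: power_mult_distrib)
      then show ?thesis by (simp add: power_add)
    qed
    also have "ennreal \<dots> = ennreal (40 * (3/5)^j) * ennreal ((5/3)^(n + j) * dyadic_sum (n + j) g)"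
      by (rule ennreal_mult) (auto simp: dyadic_sum_nonneg)
    finally show ?thesis .
  qed
  have "(\<integral>\<^sup>+ x. \<integral>\<^sup>+ y. H x y \<partial>lborel \<partial>lborel)
      = (\<Sum>j. \<Sum>n. \<integral>\<^sup>+ x. \<integral>\<^sup>+ y. K n x y * (ennreal (2^j) * b (n + j) x) \<partial>lborel \<partial>lborel)"
  proof -
    have K_x [measurable]: "K n x \<in> borel_measurable borel" for n x
      unfolding K_def by measurable
    have "(\<integral>\<^sup>+ y. H x y \<partial>lborel) = (\<Sum>j. \<Sum>n. \<integral>\<^sup>+ y. K n x y * (ennreal (2^j) * b (n + j) x) \<partial>lborel)" for x
      unfolding H_def by (subst nn_integral_suminf, measurable)+
    then show ?thesis
      unfolding inner by (simp add: nn_integral_suminf)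
  qed
  also have "\<dots> \<le> (\<Sum>j. \<Sum>n. ennreal (40 * (3/5)^j) * ennreal ((5/3)^(n + j) * dyadic_sum (n + j) g))"
    by (intro suminf_le summableI HK)
  also have "\<dots> \<le> (\<Sum>j. ennreal (40 * (3/5)^j) * Z)"
  proof (intro suminf_le summableI)
    fix j
    have "(\<Sum>n. ennreal ((5/3)^(n + j) * dyadic_sum (n + j) g)) \<le> Z"
      unfolding Z_def using suminf_offset[of "\<lambda>n. ennreal ((5/3)^n * dyadic_sum n g)" j] by simp
    then show "(\<Sum>n. ennreal (40 * (3/5)^j) * ennreal ((5/3)^(n + j) * dyadic_sum (n + j) g)) \<le> ennreal (40 * (3/5)^j) * Z"
      by (simp add: mult_left_mono)
  qed
  also have "\<dots> = (\<Sum>j. ennreal (40 * (3/5)^j)) * Z" by simp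
  also have "(\<Sum>j. ennreal (40 * (3/5)^j)) = ennreal 100"
  proof -
    have "(\<lambda>j. 40 * (3/5::real)^j) sums (40 * (1 / (1 - 3/5)))"
      by (intro sums_mult geometric_sums) simp
    then show ?thesis by (intro suminf_ennreal_eq) auto
  qed
  finally have H: "(\<integral>\<^sup>+ x. \<integral>\<^sup>+ y. H x y \<partial>lborel \<partial>lborel) \<le> ennreal 100 * Z" .
  have "besov_on {0..1} g \<le> (\<integral>\<^sup>+ x. \<integral>\<^sup>+ y. H x y + H y x \<partial>lborel \<partial>lborel)"
    unfolding besov_on_def by (intro nn_integral_mono pw)
  also have "\<dots> = (\<integral>\<^sup>+ x. \<integral>\<^sup>+ y. H x y \<partial>lborel \<partial>lborel) + (\<integral>\<^sup>+ x. \<integral>\<^sup>+ y. H y x \<partial>lborel \<partial>lborel)"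
    by (subst nn_integral_add, measurable)+
  also have "(\<integral>\<^sup>+ x. \<integral>\<^sup>+ y. H y x \<partial>lborel \<partial>lborel) = (\<integral>\<^sup>+ x. \<integral>\<^sup>+ y. H x y \<partial>lborel \<partial>lborel)"
    by (rule lborel_pair.Fubini') (simp add: case_prod_beta')
  also have "\<dots> + \<dots> \<le> ennreal 100 * Z + ennreal 100 * Z"
    by (intro add_mono H)
  also have "\<dots> = ennreal 200 * Z"
    by (simp flip: distrib_right ennreal_plus)
  finally show ?thesis unfolding Z_def .
qed

section \<open>Geometry of the gasket\<close>

definition gasket_vertices :: "complex set" where
  "gasket_vertices = {Phiw w (q i) | w i. set w \<subseteq> {0,1,2} \<and> i \<in> {0,1,2}}"

lemma gasket_vertices_Phiw:
  "w \<in> words n \<Longrightarrow> i \<in> {0,1,2} \<Longrightarrow> Phiw w (q i) \<in> gasket_vertices"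
  unfolding gasket_vertices_def words_def by blast

lemma dist_Phiw: "dist (Phiw w x) (Phiw w y) = dist x y / 2 ^ length w"
proof (induction w)
  case (Cons i w)
  have "dist (Phiw (i # w) x) (Phiw (i # w) y) = dist (Phiw w x) (Phiw w y) / 2"
    by (simp add: Phi_def dist_norm norm_divide flip: diff_divide_distrib)
  then show ?case using Cons by simp
qed simp

lemma continuous_on_Phiw: "continuous_on A (Phiw w)"
  by (induction w) (auto simp: comp_def Phi_def intro!: continuous_intros)

lemma continuous_on_Phi: "continuous_on A (Phi i)"
  unfolding Phi_def by (intro continuous_intros) auto

lemma Phi_gasket_vertices: "(\<Union>i\<in>{0,1,2}. Phi i ` gasket_vertices) = gasket_vertices"
proof (intro equalityI subsetI)
  fix x assume "x \<in> (\<Union>i\<in>{0,1,2}. Phi i ` gasket_vertices)"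
  then obtain i w j where "x = Phiw (i # w) (q j)" "set (i # w) \<subseteq> {0,1,2}" "j \<in> {0,1,2}"
    unfolding gasket_vertices_def by auto
  then show "x \<in> gasket_vertices" unfolding gasket_vertices_def by blast
next
  fix x assume "x \<in> gasket_vertices"
  then obtain w j where x: "x = Phiw w (q j)" and w: "set w \<subseteq> {0,1,2}" and j: "j \<in> {0,1,2}"
    unfolding gasket_vertices_def by blast
  show "x \<in> (\<Union>i\<in>{0,1,2}. Phi i ` gasket_vertices)"
  proof (cases w)
    case Nil
    then have "x = Phi j (Phiw [] (q j))" using x by (simp add: Phi_q_self)
    moreover have "Phiw [] (q j) \<in> gasket_vertices"
      using j by (intro gasket_vertices_Phiw[of "[]" 0]) (auto simp: words_0)
    ultimately show ?thesis using j by blast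
  next
    case (Cons c v)
    then have "x = Phi c (Phiw v (q j))" "c \<in> {0,1,2}" "set v \<subseteq> {0,1,2}" using x w by auto
    moreover have "Phiw v (q j) \<in> gasket_vertices"
      using \<open>set v \<subseteq> {0,1,2}\<close> j unfolding gasket_vertices_def by blast
    ultimately show ?thesis by blast
  qed
qed

lemma norm_q: "norm (q i) \<le> 1"
  by (simp add: q_def cmod_def power_divide)

lemma bounded_gasket_vertices: "bounded gasket_vertices"
proof (rule boundedI)
  fix x assume "x \<in> gasket_vertices"
  then obtain w i where x: "x = Phiw w (q i)"
    unfolding gasket_vertices_def by blast
  show "norm x \<le> 1" unfolding x
  proof (induction w)
    case (Cons c w)
    have "norm (Phiw (c # w) (q i)) = norm (Phiw w (q i) / 2 + q c / 2)" by (simp add: Phi_def)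
    also have "\<dots> \<le> norm (Phiw w (q i) / 2) + norm (q c / 2)" by (rule norm_triangle_ineq)
    finally have "norm (Phiw (c # w) (q i)) \<le> norm (Phiw w (q i) / 2) + norm (q c / 2)" .
    then show ?case using Cons norm_q[of c] by (simp add: norm_divide)
  qed (simp add: norm_q)
qed

lemma compact_closure_gasket_vertices: "compact (closure gasket_vertices)"
  using bounded_gasket_vertices by (simp add: compact_closure)

lemma gasket_attractor:
  "closure gasket_vertices = (\<Union>i\<in>{0,1,2}. Phi i ` closure gasket_vertices)"
proof
  let ?U = "\<Union>i\<in>{0,1,2}. Phi i ` closure gasket_vertices"
  have "compact ?U"
    by (intro compact_UN compact_continuous_image continuous_on_Phi compact_closure_gasket_vertices)
      simp
  moreover have "(\<Union>i\<in>{0,1,2}. Phi i ` gasket_vertices) \<subseteq> ?U"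
    by (intro UN_mono image_mono closure_subset order_refl)
  then have "gasket_vertices \<subseteq> ?U"
    unfolding Phi_gasket_vertices .
  ultimately show "closure gasket_vertices \<subseteq> ?U"
    by (intro closure_minimal compact_imp_closed)
  have "Phi i ` closure gasket_vertices \<subseteq> closure gasket_vertices" if "i \<in> {0,1,2}" for i
  proof (rule image_closure_subset)
    have "Phi i ` gasket_vertices \<subseteq> gasket_vertices"
      using equalityD1[OF Phi_gasket_vertices] that by blast
    then show "Phi i ` gasket_vertices \<subseteq> closure gasket_vertices"
      using closure_subset by (rule order_trans)
  qed (simp_all add: continuous_on_Phi)
  then show "?U \<subseteq> closure gasket_vertices" by (rule UN_least)
qed

text \<open>Iterating the i-th contraction on any point of K converges to its fixed point
  \<open>q i\<close>, and K is closed and invariant.\<close>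

lemma attractor_contains_vertices:
  assumes K: "compact K" "K \<noteq> {}" "K = (\<Union>i\<in>{0,1,2}. Phi i ` K)"
  shows "gasket_vertices \<subseteq> K"
proof
  have Phi_K: "Phi i x \<in> K" if "i \<in> {0,1,2}" "x \<in> K" for i x
    by (rule subsetD[OF equalityD2[OF K(3)]]) (rule UN_I[OF that(1) imageI[OF that(2)]])
  have Phiw_K: "Phiw w x \<in> K" if "set w \<subseteq> {0,1,2}" "x \<in> K" for w x
    using that(1)
  proof (induction w)
    case (Cons c w)
    then have "Phi c (Phiw w x) \<in> K" by (intro Phi_K) auto
    then show ?case by simp
  qed (simp add: that(2))
  have q_K: "q i \<in> K" if i: "i \<in> {0,1,2}" for i
  proof -
    obtain x where x: "x \<in> K" using K(2) by blast
    have "Phiw (replicate n i) (q i) = q i" for n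
      by (induction n) (auto simp: Phi_q_self)
    then have "dist (Phiw (replicate n i) x) (q i) = dist x (q i) / 2^n" for n
      using dist_Phiw[of "replicate n i" x "q i"] by simp
    then have lim: "(\<lambda>n. Phiw (replicate n i) x) \<longlonglongrightarrow> q i"
      by (subst tendsto_dist_iff) (simp add: LIMSEQ_divide_realpow_zero)
    have "Phiw (replicate n i) x \<in> K" for n
      using i by (intro Phiw_K x) auto
    then show ?thesis
      by (rule closed_sequentially[OF compact_imp_closed[OF K(1)] _ lim])
  qed
  fix x assume "x \<in> gasket_vertices"
  then obtain w i where "x = Phiw w (q i)" "set w \<subseteq> {0,1,2}" "i \<in> {0,1,2}"
    unfolding gasket_vertices_def by blast
  then show "x \<in> K" by (simp only: Phiw_K q_K)
qed

text \<open>Every point of K lies in the image of K under some word of each length n, and such an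
  image is within a multiple of 2^-n of a vertex.\<close>

lemma attractor_in_closure_vertices:
  assumes K: "compact K" "K = (\<Union>i\<in>{0,1,2}. Phi i ` K)"
  shows "K \<subseteq> closure gasket_vertices"
proof
  fix x assume "x \<in> K"
  have address: "\<exists>w\<in>words n. \<exists>y\<in>K. x = Phiw w y" if "x \<in> K" for n x
    using that
  proof (induction n arbitrary: x)
    case (Suc n)
    have "x \<in> (\<Union>i\<in>{0,1,2}. Phi i ` K)"
      by (rule subsetD[OF equalityD1[OF K(2)] Suc.prems])
    then obtain c y where c: "c \<in> {0,1,2}" "y \<in> K" "x = Phi c y" by blast
    obtain w z where w: "w \<in> words n" "z \<in> K" "y = Phiw w z" using Suc.IH[OF c(2)] by blast
    then have "c # w \<in> words (Suc n)" "x = Phiw (c # w) z" using c by (auto simp: words_def)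
    then show ?case using w by blast
  qed (auto simp: words_0)
  obtain B where B: "\<And>y. y \<in> K \<Longrightarrow> dist y (q 0) \<le> B" "0 < B"
  proof -
    obtain B where "\<And>y. y \<in> K \<Longrightarrow> dist (q 0) y \<le> B"
      using compact_imp_bounded[OF K(1)] bounded_any_center[of K "q 0"] by blast
    then show ?thesis by (intro that[of "max B 1"]) (auto simp: dist_commute le_max_iff_disj)
  qed
  show "x \<in> closure gasket_vertices"
    unfolding closure_approachable
  proof (intro allI impI)
    fix e :: real assume "0 < e"
    then obtain n where n: "(1/2)^n < e / B"
      using real_arch_pow_inv[of "e / B" "1/2"] B by auto
    obtain w y where w: "w \<in> words n" "y \<in> K" "x = Phiw w y" using address[OF \<open>x \<in> K\<close>] by blast
    have "dist (Phiw w (q 0)) x = dist y (q 0) / 2^n"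
      using w by (simp add: dist_Phiw words_def dist_commute)
    also have "\<dots> \<le> B * (1/2)^n" using B(1)[OF w(2)] by (simp add: power_one_over divide_right_mono)
    also have "\<dots> < e" using n B(2) by (simp add: field_simps)
    finally show "\<exists>y\<in>gasket_vertices. dist y x < e"
      using gasket_vertices_Phiw[OF w(1), of 0] by auto
  qed
qed

text \<open>Existence and uniqueness of the attractor in one: both inclusions for an arbitrary
  compact nonempty solution resolve the definite description.\<close>

lemma SG_eq: "SG = closure gasket_vertices"
  unfolding SG_def
proof (rule the_equality, intro conjI)
  show "closure gasket_vertices \<noteq> {}"
    using gasket_vertices_Phiw[of "[]" 0 0] by (auto simp: words_0)
next
  fix K assume *: "compact K \<and> K \<noteq> {} \<and> K = (\<Union>i\<in>{0,1,2}. Phi i ` K)"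
  note K = *[THEN conjunct1] *[THEN conjunct2, THEN conjunct1] *[THEN conjunct2, THEN conjunct2]
  have 1: "gasket_vertices \<subseteq> K" by (rule attractor_contains_vertices[OF K])
  have 2: "K \<subseteq> closure gasket_vertices" by (rule attractor_in_closure_vertices[OF K(1,3)])
  show "K = closure gasket_vertices"
    by (rule equalityI[OF 2 closure_minimal[OF 1 compact_imp_closed[OF K(1)]]])
qed (rule compact_closure_gasket_vertices, rule gasket_attractor)

section \<open>Intersections of cells\<close>

text \<open>Barycentric coordinates with respect to the vertices \<open>q\<close>.\<close>
definition bary :: "nat \<Rightarrow> complex \<Rightarrow> real" where
  "bary i z = (if i = 0 then 1 - Re z - Im z / sqrt 3
     else if i = 1 then Re z - Im z / sqrt 3 else 2 * Im z / sqrt 3)"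

definition base_triangle :: "complex set" where
  "base_triangle = {z. \<forall>i\<in>{0,1,2}. 0 \<le> bary i z}"

lemma bary_q: "i \<in> {0,1,2} \<Longrightarrow> j \<in> {0,1,2} \<Longrightarrow> bary i (q j) = (if i = j then 1 else 0)"
  by (auto simp: bary_def q_def)

lemma bary_Phi: "i \<in> {0,1,2} \<Longrightarrow> j \<in> {0,1,2} \<Longrightarrow> bary i (Phi j x) = bary i x / 2 + (if i = j then 1/2 else 0)"
  by (auto simp: bary_def Phi_def q_def field_simps)

lemma bary_sum: "bary 0 z + bary 1 z + bary 2 z = 1"
  by (simp add: bary_def)

lemma bary_eq_imp_eq:
  assumes "bary 1 x = bary 1 y" "bary 2 x = bary 2 y"
  shows "x = y"
proof -
  have "Im x = Im y" using assms(2) by (simp add: bary_def)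
  moreover from this have "Re x = Re y" using assms(1) by (simp add: bary_def)
  ultimately show ?thesis by (simp add: complex_eq_iff)
qed

lemma bary_le_1: "z \<in> base_triangle \<Longrightarrow> i \<in> {0,1,2} \<Longrightarrow> bary i z \<le> 1"
  using bary_sum[of z] by (auto simp: base_triangle_def)

lemma bary_eq_1:
  assumes z: "z \<in> base_triangle" and i: "i \<in> {0,1,2}" and 1: "bary i z = 1"
  shows "z = q i"
proof (rule bary_eq_imp_eq)
  have "0 \<le> bary 0 z" "0 \<le> bary 1 z" "0 \<le> bary 2 z" using z by (auto simp: base_triangle_def)
  then have "bary k z = (if k = i then 1 else 0)" if "k \<in> {0,1,2}" for k
    using bary_sum[of z] 1 i that by auto
  then show "bary 1 z = bary 1 (q i)" "bary 2 z = bary 2 (q i)"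
    using i by (simp_all add: bary_q)
qed

lemma Phiw_base_triangle: "set w \<subseteq> {0,1,2} \<Longrightarrow> x \<in> base_triangle \<Longrightarrow> Phiw w x \<in> base_triangle"
  by (induction w) (auto simp: base_triangle_def bary_Phi)

lemma SG_subset_base_triangle: "SG \<subseteq> base_triangle"
  unfolding SG_eq
proof (rule closure_minimal)
  show "gasket_vertices \<subseteq> base_triangle"
  proof
    fix x assume "x \<in> gasket_vertices"
    then obtain w i where x: "x = Phiw w (q i)" "set w \<subseteq> {0,1,2}" "i \<in> {0,1,2}"
      unfolding gasket_vertices_def by blast
    then have "q i \<in> base_triangle" by (auto simp: base_triangle_def bary_q)
    then show "x \<in> base_triangle" unfolding x(1) by (rule Phiw_base_triangle[OF x(2)])
  qed
  have "continuous_on UNIV (bary i)" for i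
    unfolding bary_def[abs_def] by (cases "i = 0"; cases "i = 1"; simp; intro continuous_intros; simp)
  then have closed: "closed {z. 0 \<le> bary i z}" for i
    by (intro closed_Collect_le continuous_on_const)
  have eq: "base_triangle = {z. 0 \<le> bary 0 z} \<inter> {z. 0 \<le> bary 1 z} \<inter> {z. 0 \<le> bary 2 z}"
    by (auto simp: base_triangle_def)
  show "closed base_triangle" unfolding eq by (intro closed_Int closed)
qed

text \<open>A corner of the triangle is an extreme point, so it lies in a cell only as a corner of it.\<close>
lemma Phiw_eq_q:
  assumes "set w \<subseteq> {0,1,2}" "x \<in> base_triangle" and i: "i \<in> {0,1,2}" and "Phiw w x = q i"
  shows "x = q i"
  using assms(1,4)
proof (induction w)
  case (Cons c w)
  then have c: "c \<in> {0,1,2}" and w: "set w \<subseteq> {0,1,2}" by auto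
  have "bary i (Phi c (Phiw w x)) = 1" using Cons.prems i by (simp add: bary_q)
  then have "bary i (Phiw w x) / 2 + (if i = c then 1/2 else 0) = 1" by (simp only: bary_Phi[OF i c])
  with bary_le_1[OF Phiw_base_triangle[OF w assms(2)] i] have "bary i (Phiw w x) = 1"
    by (simp split: if_splits)
  then have "Phiw w x = q i" by (rule bary_eq_1[OF Phiw_base_triangle[OF w assms(2)] i])
  then show ?case by (rule Cons.IH[OF w])
qed simp

lemma Phi_inj: "Phi i x = Phi i y \<Longrightarrow> x = y"
  by (simp add: Phi_def)

text \<open>After the common prefix the words differ in letters a and a'. In coordinate a the first
  child triangle lies at or above 1/2 and the second at or below it, so equality holds and the
  common point is the corner a of the second. Exchanging the roles gives the corner a' of the first.
  Extremality of corners carries this down to y and z.\<close>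

lemma cells_meet_in_vertices:
  assumes "w \<in> words n" "w' \<in> words n" "w \<noteq> w'" and yz: "y \<in> base_triangle" "z \<in> base_triangle"
    and "Phiw w y = Phiw w' z"
  shows "\<exists>i\<in>{0,1,2}. \<exists>j\<in>{0,1,2}. y = q i \<and> z = q j"
  using assms(1,2,3,6)
proof (induction n arbitrary: w w')
  case (Suc n)
  obtain a v where w: "w = a # v" "a \<in> {0,1,2}" "v \<in> words n" "set v \<subseteq> {0,1,2}"
    using Suc.prems(1) by (cases w) (auto simp: words_def)
  obtain a' v' where w': "w' = a' # v'" "a' \<in> {0,1,2}" "v' \<in> words n" "set v' \<subseteq> {0,1,2}"
    using Suc.prems(2) by (cases w') (auto simp: words_def)
  have eq: "Phi a (Phiw v y) = Phi a' (Phiw v' z)" using Suc.prems(4) w w' by simp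
  show ?case
  proof (cases "a = a'")
    case True
    then have "Phiw v y = Phiw v' z" using eq Phi_inj[of a] by simp
    moreover have "v \<noteq> v'" using Suc.prems(3) True w(1) w'(1) by simp
    ultimately show ?thesis by (intro Suc.IH[OF w(3) w'(3)])
  next
    case False
    have t: "Phiw v y \<in> base_triangle" "Phiw v' z \<in> base_triangle"
      by (rule Phiw_base_triangle[OF w(4) yz(1)], rule Phiw_base_triangle[OF w'(4) yz(2)])
    have "bary a (Phi a (Phiw v y)) = bary a (Phi a' (Phiw v' z))" using eq by simp
    then have "bary a (Phiw v y) + 1 = bary a (Phiw v' z)"
      using w(2) w'(2) False by (simp only: bary_Phi) auto
    moreover have "0 \<le> bary a (Phiw v y)" using t w by (auto simp: base_triangle_def)
    ultimately have "bary a (Phiw v' z) = 1" using bary_le_1[OF t(2) w(2)] by simp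
    then have z: "z = q a" by (intro Phiw_eq_q[OF w'(4) yz(2) w(2)] bary_eq_1[OF t(2) w(2)])
    have "bary a' (Phi a (Phiw v y)) = bary a' (Phi a' (Phiw v' z))" using eq by simp
    then have "bary a' (Phiw v y) = bary a' (Phiw v' z) + 1"
      using w(2) w'(2) False by (simp only: bary_Phi) auto
    moreover have "0 \<le> bary a' (Phiw v' z)" using t w' by (auto simp: base_triangle_def)
    ultimately have "bary a' (Phiw v y) = 1" using bary_le_1[OF t(1) w'(2)] by simp
    then have "y = q a'" by (intro Phiw_eq_q[OF w(4) yz(1) w'(2)] bary_eq_1[OF t(1) w'(2)])
    with z show ?thesis using w(2) w'(2) by blast
  qed
qed (simp add: words_0)

section \<open>Continuity of functions of finite energy\<close>

text \<open>The child \<open>w @ [c]\<close> shares the corner c with its parent, so a descent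
  through the address moves between corners of one cell at a time. The constant solves C = 4 + (4/3)
  * (3/5) * C, that is C = 20.\<close>

lemma cell_osc_le:
  assumes f: "\<And>n w. w \<in> words n \<Longrightarrow> cell_energy f w \<le> (3/5)^n * M"
    and "w \<in> words n" "set v \<subseteq> {0,1,2}" "i \<in> {0,1,2}" "j \<in> {0,1,2}"
  shows "(f (Phiw (w @ v) (q i)) - f (Phiw w (q j)))\<^sup>2 \<le> 20 * ((3/5)^n * M)"
  using assms(2-)
proof (induction v arbitrary: w n j)
  have *: "(f (Phiw w (q i)) - f (Phiw w (q j)))\<^sup>2 \<le> (3/5)^n * M"
    if "w \<in> words n" "i \<in> {0,1,2}" "j \<in> {0,1,2}" for w n i j
  proof -
    have "(f (Phiw w (q i)) - f (Phiw w (q j)))\<^sup>2 \<le> cell_energy f w"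
      using that(2,3) by (auto simp: cell_energy_def power2_commute)
    with f[OF that(1)] show ?thesis by linarith
  qed
  {
    case Nil
    from *[OF Nil(1,3,4)] cell_energy_nonneg[of f w] f[OF Nil(1)] show ?case by simp
  next
    case (Cons c v)
    then have c: "c \<in> {0,1,2}" "set v \<subseteq> {0,1,2}" by auto
    let ?p = "f (Phiw (w @ c # v) (q i))"
    have "(?p - f (Phiw (w @ [c]) (q c)))\<^sup>2 \<le> 20 * ((3/5)^Suc n * M)"
      using Cons.IH[OF snoc_in_words[OF Cons.prems(1) c(1)] c(2) Cons.prems(3) c(1)] by simp
    then have "(?p - f (Phiw w (q c)))\<^sup>2 \<le> 12 * ((3/5)^n * M)"
      unfolding Phiw_snoc_q_self by (simp add: mult_ac)
    moreover have "(f (Phiw w (q c)) - f (Phiw w (q j)))\<^sup>2 \<le> (3/5)^n * M"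
      using Cons.prems c by (intro *)
    ultimately show ?case
      using power2_add_le_weighted[of "f (Phiw w (q c)) - f (Phiw w (q j))" "?p - f (Phiw w (q c))"]
      by simp
  }
qed

text \<open>Since \<open>q i\<close> is fixed by the i-th contraction, padding an address with the
  letter i leaves the vertex unchanged and makes the address as long as desired.\<close>

lemma vertex_address:
  assumes "x \<in> gasket_vertices"
  obtains w v i where "w \<in> words n" "set v \<subseteq> {0,1,2}" "i \<in> {0,1,2}" "x = Phiw (w @ v) (q i)"
proof -
  obtain u i where x: "x = Phiw u (q i)" and u: "set u \<subseteq> {0,1,2}" and i: "i \<in> {0,1,2}"
    using assms unfolding gasket_vertices_def by blast
  have "Phiw (replicate n i) (q i) = q i" by (induction n) (auto simp: Phi_q_self)
  then have x': "x = Phiw (u @ replicate n i) (q i)" by (simp add: x Phiw_append)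
  have set: "set (u @ replicate n i) \<subseteq> {0,1,2}" using u i by auto
  let ?u = "u @ replicate n i"
  show ?thesis
  proof (rule that[of "take n ?u" "drop n ?u" i])
    show "take n ?u \<in> words n"
      using set set_take_subset[of n ?u] by (auto simp: words_def)
    show "set (drop n ?u) \<subseteq> {0,1,2}" using set set_drop_subset[of n ?u] by blast
    show "x = Phiw (take n ?u @ drop n ?u) (q i)" unfolding append_take_drop_id by (rule x')
  qed (rule i)
qed

text \<open>Disjoint cells of level n are finitely many compact pairs, hence a positive distance
  apart. Vertices closer than that lie in cells that meet, so a shared corner connects them.\<close>

lemma finite_energy_uniformly_continuous:
  assumes f: "\<And>n w. w \<in> words n \<Longrightarrow> cell_energy f w \<le> (3/5)^n * M"
  shows "uniformly_continuous_on gasket_vertices f"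
  unfolding uniformly_continuous_on_def
proof (intro allI impI)
  fix e :: real assume e: "0 < e"
  \<comment> \<open>80 = 2 * 20 + 2 * 20, for the two passages from x and from y to the shared
    corner.\<close>
  have "(\<lambda>n. 80 * ((3/5::real)^n * M)) \<longlonglongrightarrow> 80 * (0 * M)"
    by (intro tendsto_intros LIMSEQ_power_zero) simp
  then have "\<forall>\<^sub>F n in sequentially. 80 * ((3/5::real)^n * M) < e\<^sup>2"
    by (rule order_tendstoD(2)) (use e in simp)
  then obtain n where n: "80 * ((3/5::real)^n * M) < e\<^sup>2"
    by (auto simp: eventually_sequentially)
  let ?C = "\<lambda>w. Phiw w ` SG"
  define P where "P = {(w, w') \<in> words n \<times> words n. ?C w \<inter> ?C w' = {}}"
  have "finite P"
    by (rule finite_subset[of _ "words n \<times> words n"]) (auto simp: P_def finite_words)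
  have compact: "compact (?C w)" for w
    unfolding SG_eq by (intro compact_continuous_image continuous_on_Phiw compact_closure_gasket_vertices)
  have "\<forall>p\<in>P. \<exists>d>0. \<forall>x\<in>?C (fst p). \<forall>y\<in>?C (snd p). d \<le> dist x y"
  proof
    fix p assume "p \<in> P"
    then have "?C (fst p) \<inter> ?C (snd p) = {}" by (auto simp: P_def)
    then show "\<exists>d>0. \<forall>x\<in>?C (fst p). \<forall>y\<in>?C (snd p). d \<le> dist x y"
      by (rule separate_compact_closed[OF compact compact_imp_closed[OF compact]])
  qed
  from bchoice[OF this] obtain d
    where d: "\<forall>p\<in>P. 0 < d p \<and> (\<forall>x\<in>?C (fst p). \<forall>y\<in>?C (snd p). d p \<le> dist x y)" ..
  \<comment> \<open>The inserted 1 keeps the minimum meaningful when no two cells are disjoint, as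
    at level 0.\<close>
  define r where "r = Min (insert 1 (d ` P))"
  have r: "r > 0" "\<And>p. p \<in> P \<Longrightarrow> r \<le> d p"
    unfolding r_def using \<open>finite P\<close> d by auto
  have "dist (f y) (f x) < e" if x: "x \<in> gasket_vertices" and y: "y \<in> gasket_vertices" and xy: "dist y x < r" for x y
  proof -
    obtain w v i where w: "w \<in> words n" "set v \<subseteq> {0,1,2}" "i \<in> {0,1,2}" "x = Phiw (w @ v) (q i)"
      by (rule vertex_address[OF x])
    obtain w' v' i' where w': "w' \<in> words n" "set v' \<subseteq> {0,1,2}" "i' \<in> {0,1,2}" "y = Phiw (w' @ v') (q i')"
      by (rule vertex_address[OF y])
    have in_SG: "Phiw v (q i) \<in> SG" if "set v \<subseteq> {0,1,2}" "i \<in> {0,1,2}" for v i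
    proof -
      have "v \<in> words (length v)" using that by (simp add: words_def)
      then show ?thesis
        unfolding SG_eq by (rule subsetD[OF closure_subset gasket_vertices_Phiw[OF _ that(2)]])
    qed
    have "x \<in> ?C w" "y \<in> ?C w'"
      unfolding w(4) w'(4) Phiw_append by (intro imageI in_SG w w')+
    then have "d (w, w') \<le> dist x y" if "(w, w') \<in> P"
      using d that by fastforce
    then have "(w, w') \<notin> P"
      using r(2)[of "(w, w')"] xy by (fastforce simp: dist_commute)
    then have "?C w \<inter> ?C w' \<noteq> {}"
      using w(1) w'(1) by (simp add: P_def)
    then obtain s t where st: "s \<in> SG" "t \<in> SG" "Phiw w s = Phiw w' t"
      by blast
    have "\<exists>j\<in>{0,1,2}. \<exists>k\<in>{0,1,2}. Phiw w (q j) = Phiw w' (q k)"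
    proof (cases "w = w'")
      case False
      have "s \<in> base_triangle" "t \<in> base_triangle"
        using st SG_subset_base_triangle by auto
      then show ?thesis
        using cells_meet_in_vertices[OF w(1) w'(1) False _ _ st(3)] st(3) by blast
    next
      case True
      then show ?thesis by (intro bexI[of _ 0]) simp_all
    qed
    then obtain j k where jk: "j \<in> {0,1,2}" "k \<in> {0,1,2}" "Phiw w (q j) = Phiw w' (q k)" by blast
    have "(f x - f (Phiw w (q j)))\<^sup>2 \<le> 20 * ((3/5)^n * M)" "(f y - f (Phiw w (q j)))\<^sup>2 \<le> 20 * ((3/5)^n * M)"
      using cell_osc_le[OF f w(1-3) jk(1)] cell_osc_le[OF f w'(1-3) jk(2)] w(4) w'(4) jk(3) by auto
    then have "(f y - f x)\<^sup>2 \<le> 80 * ((3/5)^n * M)"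
      using power2_add_le[of "f y - f (Phiw w (q j))" "f (Phiw w (q j)) - f x"]
      by (simp add: power2_commute[of "f (Phiw w (q j))"])
    with n have "\<bar>f y - f x\<bar>\<^sup>2 < e\<^sup>2" by simp
    then show ?thesis
      unfolding dist_real_def by (rule power_less_imp_less_base) (use e in simp)
  qed
  with r(1) show "\<exists>d>0. \<forall>x\<in>gasket_vertices. \<forall>x'\<in>gasket_vertices. dist x' x < d \<longrightarrow> dist (f x') (f x) < e"
    by blast
qed

section \<open>Traces on the graph approximations\<close>

text \<open>Halving an edge leads to edges of child cells, so its dyadic points are corners of
  deeper cells. They are dense in the edge, which links values on edges to values at
  vertices.\<close>

lemma edge_dyadic_in_vertices:
  assumes "w \<in> words m" "i \<in> {0,1,2}" "j \<in> {0,1,2}" "k \<le> 2^n"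
  shows "edge w i j (real k / 2^n / 2^m) \<in> gasket_vertices"
  using assms
proof (induction n arbitrary: w m k)
  case 0
  then have "length w = m" "k = 0 \<or> k = 1" by (auto simp: words_def)
  then show ?case
    using 0 gasket_vertices_Phiw edge_conv_Phiw[of w i j "real k"] by auto
next
  case (Suc n)
  have m: "length w = m" "length (w @ [c]) = Suc m" for c using Suc.prems(1) by (auto simp: words_def)
  show ?case
  proof (cases "k \<le> 2^n")
    case True
    have "edge w i j (real k / 2^Suc n / 2^m) = edge (w @ [i]) i j (real k / 2^n / 2^Suc m)"
      using edge_conv_Phiw[of w i j "real k / 2^Suc n"] edge_conv_Phiw[of "w @ [i]" i j "real k / 2^n"]
      unfolding m by (simp add: Phiw_append Phi_def field_simps)
    then show ?thesis
      using Suc.IH[OF snoc_in_words[OF Suc.prems(1,2)] Suc.prems(2,3) True] by simp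
  next
    case False
    then obtain l where l: "k = 2^n + l" "l \<le> 2^n"
      using Suc.prems(4) by (metis add_le_cancel_left le_add_diff_inverse linorder_linear mult_2 power_Suc)
    have "edge w i j (real k / 2^Suc n / 2^m) = edge (w @ [j]) i j (real l / 2^n / 2^Suc m)"
      using edge_conv_Phiw[of w i j "real k / 2^Suc n"] edge_conv_Phiw[of "w @ [j]" i j "real l / 2^n"]
      unfolding m by (simp add: Phiw_append Phi_def field_simps l(1))
    then show ?thesis
      using Suc.IH[OF snoc_in_words[OF Suc.prems(1,3)] Suc.prems(2,3) l(2)] by simp
  qed
qed

lemma edge_dyadic_floor_tendsto:
  assumes "0 \<le> t"
  shows "(\<lambda>n. edge w i j (dyadic_floor n t / 2^m)) \<longlonglongrightarrow> edge w i j (t / 2^m)"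
  unfolding edge_def by (intro tendsto_intros dyadic_floor_tendsto assms) simp

lemma edge_dyadic_floor_in_vertices:
  assumes "w \<in> words m" "i \<in> {0,1,2}" "j \<in> {0,1,2}" "t \<in> {0..1}"
  shows "edge w i j (dyadic_floor n t / 2^m) \<in> gasket_vertices"
  unfolding dyadic_floor_def using assms by (intro edge_dyadic_in_vertices dyadic_index_le) auto

lemma edges_eq: "edges m = words m \<times> {(0,1), (0,2), (1,2)}"
  by (auto simp: edges_def)

lemma edge_in_SGm:
  assumes "(w, i, j) \<in> edges m" "t \<in> {0..1}"
  shows "edge w i j (t / 2^m) \<in> SGm m"
proof -
  have "t / 2^m \<in> {0..edge_len m}"
    using assms(2) by (auto simp: edge_len_def power_one_over divide_right_mono)
  with assms(1) show ?thesis unfolding SGm_def by blast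
qed

lemma SGm_cases:
  assumes "x \<in> SGm m"
  obtains w i j t where "(w, i, j) \<in> edges m" "t \<in> {0..1}" "x = edge w i j (t / 2^m)"
proof -
  obtain w i j s where *: "(w, i, j) \<in> edges m" "s \<in> {0..edge_len m}" "x = edge w i j s"
    using assms unfolding SGm_def by blast
  have "s * 2^m \<in> {0..1}" using *(2) by (auto simp: edge_len_def power_one_over field_simps)
  with * show ?thesis by (intro that[of w i j "s * 2^m"]) auto
qed

lemma SGm_subset_SG: "SGm m \<subseteq> SG"
proof
  fix x assume "x \<in> SGm m"
  then obtain w i j t where x: "(w, i, j) \<in> edges m" "t \<in> {0..1}" "x = edge w i j (t / 2^m)"
    by (rule SGm_cases)
  then have w: "w \<in> words m" "i \<in> {0,1,2}" "j \<in> {0,1,2}" by (auto simp: edges_eq)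
  have "edge w i j (dyadic_floor n t / 2^m) \<in> closure gasket_vertices" for n
    using edge_dyadic_floor_in_vertices[OF w x(2)] closure_subset by blast
  moreover have "(\<lambda>n. edge w i j (dyadic_floor n t / 2^m)) \<longlonglongrightarrow> edge w i j (t / 2^m)"
    using x(2) by (intro edge_dyadic_floor_tendsto) simp
  ultimately show "x \<in> SG"
    unfolding SG_eq x(3) by (rule closed_sequentially[OF closed_closure])
qed

lemma vertex_in_SGm:
  assumes "w \<in> words m" "i \<in> {0,1,2}"
  shows "Phiw w (q i) \<in> SGm m"
proof -
  have m: "length w = m" using assms by (simp add: words_def)
  have "edge w 0 1 (0 / 2^m) \<in> SGm m" "edge w 0 1 (1 / 2^m) \<in> SGm m" "edge w 0 2 (1 / 2^m) \<in> SGm m"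
    using assms(1) by (auto intro!: edge_in_SGm simp: edges_eq simp del: div_0)
  then show ?thesis
    using assms(2) edge_conv_Phiw[of w 0 1 0] edge_conv_Phiw[of w 0 1 1] edge_conv_Phiw[of w 0 2 1]
    unfolding m by auto
qed

text \<open>Constant continuation beyond both ends: the interval estimates ask for continuity on the
  whole line, while their seminorms and sums see only the unit interval.\<close>

definition clamp_edge_fun :: "(complex \<Rightarrow> real) \<Rightarrow> nat list \<Rightarrow> nat \<Rightarrow> nat \<Rightarrow> real \<Rightarrow> real" where
  "clamp_edge_fun f w i j t = edge_fun f w i j (max 0 (min 1 t))"

lemma clamp_edge_fun_eq: "t \<in> {0..1} \<Longrightarrow> clamp_edge_fun f w i j t = edge_fun f w i j t"
  by (simp add: clamp_edge_fun_def)

lemma continuous_clamp_edge_fun: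
  assumes "continuous_on (SGm m) f" "(w, i, j) \<in> edges m"
  shows "continuous_on UNIV (clamp_edge_fun f w i j)"
proof -
  have m: "length w = m" using assms(2) by (auto simp: edges_eq words_def)
  show ?thesis
    unfolding clamp_edge_fun_def edge_fun_def m
  proof (rule continuous_on_compose2[OF assms(1)])
    show "continuous_on UNIV (\<lambda>t. edge w i j (max 0 (min 1 t) / 2^m))"
      unfolding edge_def by (intro continuous_intros) auto
    show "(\<lambda>t. edge w i j (max 0 (min 1 t) / 2^m)) ` UNIV \<subseteq> SGm m"
      using assms(2) by (auto intro!: edge_in_SGm)
  qed
qed

lemma dyadic_sum_clamp: "dyadic_sum n (clamp_edge_fun f w i j) = dyadic_sum n (edge_fun f w i j)"
  unfolding dyadic_sum_def
proof (intro sum.cong refl)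
  fix k :: nat assume "k \<in> {..<2^n}"
  then have "real (Suc k) \<le> real (2^n)" "real k \<le> real (2^n)"
    unfolding of_nat_le_iff by simp_all
  then have "real (Suc k) / 2^n \<in> {0..1}" "real k / 2^n \<in> {0..1}"
    by (simp_all add: divide_le_eq)
  then show "(clamp_edge_fun f w i j (real (Suc k) / 2^n) - clamp_edge_fun f w i j (real k / 2^n))\<^sup>2
      = (edge_fun f w i j (real (Suc k) / 2^n) - edge_fun f w i j (real k / 2^n))\<^sup>2"
    by (simp only: clamp_edge_fun_eq)
qed

text \<open>The factor by which the edge length rescales the seminorm is (5/3)^m, the same as in the
  renormalised energy. This is where uniformity in m comes from.\<close>

lemma Hnorm2_eq:
  assumes f: "continuous_on (SGm m) f"
  shows "Hnorm2 m f = (\<Sum>(w,i,j)\<in>edges m. ennreal ((5/3)^m) * besov_on {0..1} (clamp_edge_fun f w i j))"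
  unfolding Hnorm2_def
proof (intro sum.cong refl, clarify)
  fix w i j assume e: "(w, i, j) \<in> edges m"
  let ?g = "clamp_edge_fun f w i j"
  have m: "length w = m" using e by (auto simp: edges_eq words_def)
  have cont: "continuous_on UNIV (\<lambda>x. ?g (2^m * x))"
    using cont_comp_affine[OF continuous_clamp_edge_fun[OF f e], of UNIV 0 "2^m"] by simp
  have "(\<integral>\<^sup>+ x. \<integral>\<^sup>+ y. indicator {0..edge_len m} x * indicator {0..edge_len m} y *
        ennreal (\<bar>f (edge w i j x) - f (edge w i j y)\<bar>\<^sup>2 / \<bar>x - y\<bar> powr (1 + 2 * beta)) \<partial>lborel \<partial>lborel)
      = besov_on {0..0 + 1/2^m} (\<lambda>x. f (edge w i j x))"
    by (simp add: besov_on_def edge_len_def power_one_over)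
  also have "\<dots> = besov_on {0..0 + 1/2^m} (\<lambda>x. ?g (2^m * x))"
  proof (rule besov_on_cong)
    fix x :: real assume "x \<in> {0..0 + 1/2^m}"
    then have "2^m * x \<in> {0..1}" by (auto simp: field_simps)
    then show "f (edge w i j x) = ?g (2^m * x)"
      by (simp add: clamp_edge_fun_eq edge_fun_def m)
  qed
  also have "\<dots> = ennreal ((5/3)^m) * besov_on {0..1} ?g"
    using besov_on_affine_dyadic[OF borel_measurable_continuous_onI[OF cont], of 0 m] by simp
  finally show "(\<integral>\<^sup>+ x. \<integral>\<^sup>+ y. indicator {0..edge_len m} x * indicator {0..edge_len m} y *
        ennreal (\<bar>f (edge w i j x) - f (edge w i j y)\<bar>\<^sup>2 / \<bar>x - y\<bar> powr (1 + 2 * beta)) \<partial>lborel \<partial>lborel)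
      = ennreal ((5/3)^m) * besov_on {0..1} ?g" .
qed

text \<open>Three edges per cell turn 42 into 126, ordered pairs in \<open>Em\<close> halve it to
  63, and the dyadic bound for the seminorm contributes 200, so 12600 = 200 * 63.\<close>

lemma Hnorm2_le_energy:
  assumes f: "continuous_on (SGm m) f" and E: "\<And>n. (5/3)^n * Em n f \<le> E"
  shows "Hnorm2 m f \<le> ennreal (12600 * E)"
proof -
  let ?d = "\<lambda>n (w, i, j). (5/3)^m * ((5/3)^n * dyadic_sum n (edge_fun f w i j))"
  have fin: "finite (edges m)" by (simp add: edges_eq finite_words)
  have partial: "(\<Sum>n<N. \<Sum>e\<in>edges m. ennreal (?d n e)) \<le> ennreal (63 * E)" for N
  proof -
    have "(\<Sum>n<N. \<Sum>e\<in>edges m. ?d n e) \<le> (\<Sum>n\<le>N. \<Sum>e\<in>edges m. ?d n e)"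
      by (intro sum_mono2) (auto intro!: sum_nonneg simp: dyadic_sum_nonneg)
    also have "\<dots> = (\<Sum>e\<in>edges m. \<Sum>n\<le>N. ?d n e)"
      by (rule sum.swap)
    also have "\<dots> \<le> (\<Sum>(w, i, j)\<in>edges m. (5/3)^m * (42 * subcell_energy f N w))"
    proof (intro sum_mono, clarify)
      fix w i j assume "(w, i, j) \<in> edges m"
      then have "(\<Sum>n\<le>N. (5/3)^n * dyadic_sum n (edge_fun f w i j)) \<le> 42 * subcell_energy f N w"
        using sum_dyadic_sum_edge_le[of i j f w N] cell_energy_nonneg[of f w] by (auto simp: edges_eq)
      then show "(\<Sum>n\<le>N. (5/3)^m * ((5/3)^n * dyadic_sum n (edge_fun f w i j))) \<le> (5/3)^m * (42 * subcell_energy f N w)"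
        by (simp flip: sum_distrib_left)
    qed
    also have "\<dots> = 126 * ((5/3)^m * (\<Sum>w\<in>words m. subcell_energy f N w))"
      unfolding edges_eq by (simp add: sum.cartesian_product[symmetric] sum_distrib_left sum_distrib_right mult_ac)
    also have "\<dots> \<le> 63 * E"
      unfolding sum_subcell_energy using E[of "m + N"] by (simp add: mult_ac)
    finally have "ennreal (\<Sum>n<N. \<Sum>e\<in>edges m. ?d n e) \<le> ennreal (63 * E)" by (rule ennreal_leI)
    then show ?thesis
      by (subst sum_ennreal, simp add: case_prod_unfold dyadic_sum_nonneg,
          subst sum_ennreal) (auto simp: dyadic_sum_nonneg intro!: sum_nonneg)
  qed
  have "Hnorm2 m f \<le> (\<Sum>(w,i,j)\<in>edges m. ennreal ((5/3)^m) *
      (ennreal 200 * (\<Sum>n. ennreal ((5/3)^n * dyadic_sum n (edge_fun f w i j)))))"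
    unfolding Hnorm2_eq[OF f]
  proof (intro sum_mono, clarify)
    fix w i j assume e: "(w, i, j) \<in> edges m"
    show "ennreal ((5/3)^m) * besov_on {0..1} (clamp_edge_fun f w i j) \<le> ennreal ((5/3)^m) *
      (ennreal 200 * (\<Sum>n. ennreal ((5/3)^n * dyadic_sum n (edge_fun f w i j))))"
      using besov_le_dyadic_sum[OF continuous_clamp_edge_fun[OF f e]]
      by (intro mult_left_mono) (simp_all add: dyadic_sum_clamp)
  qed
  also have "\<dots> = ennreal 200 * (\<Sum>e\<in>edges m. \<Sum>n. ennreal (?d n e))"
    unfolding sum_distrib_left
  proof (intro sum.cong refl, clarify)
    fix w i j
    have "(\<Sum>n. ennreal ((5/3)^m * ((5/3)^n * dyadic_sum n (edge_fun f w i j))))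
      = ennreal ((5/3)^m) * (\<Sum>n. ennreal ((5/3)^n * dyadic_sum n (edge_fun f w i j)))"
      by (subst ennreal_mult) (auto simp: dyadic_sum_nonneg)
    then show "ennreal ((5/3)^m) * (ennreal 200 * (\<Sum>n. ennreal ((5/3)^n * dyadic_sum n (edge_fun f w i j))))
      = ennreal 200 * (\<Sum>n. ennreal ((5/3)^m * ((5/3)^n * dyadic_sum n (edge_fun f w i j))))"
      by (simp only: mult.left_commute)
  qed
  also have "(\<Sum>e\<in>edges m. \<Sum>n. ennreal (?d n e)) = (\<Sum>n. \<Sum>e\<in>edges m. ennreal (?d n e))"
    by (intro suminf_sum[symmetric] summableI)
  also have "\<dots> \<le> ennreal (63 * E)"
    by (intro suminf_le_const summableI partial)
  also have "ennreal 200 * ennreal (63 * E) = ennreal (12600 * E)"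
    by (subst ennreal_mult'[symmetric]) simp_all
  finally show ?thesis by (simp add: mult_left_mono)
qed

lemma endpoint_diff_le_besov_ennreal:
  assumes "continuous_on UNIV g"
  shows "ennreal ((g 1 - g 0)\<^sup>2) \<le> ennreal 40 * besov_on {0..1} g"
proof (cases "besov_on {0..1} g" rule: ennreal_cases)
  case (real M)
  then have "ennreal ((g 1 - g 0)\<^sup>2) \<le> ennreal (40 * M)"
    using endpoint_diff_le_besov[OF assms, of M] by (intro ennreal_leI) simp
  also have "\<dots> = ennreal 40 * ennreal M" using real(1) by (intro ennreal_mult) simp_all
  finally show ?thesis unfolding real(2) .
qed (simp add: ennreal_mult_top)

text \<open>80 is twice the endpoint constant 40, the 2 again coming from ordered pairs.\<close>

lemma Em_le_Hnorm2:
  assumes f: "continuous_on (SGm m) f"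
  shows "ennreal ((5/3)^m * Em m f) \<le> ennreal 80 * Hnorm2 m f"
proof -
  let ?d = "\<lambda>(w, i, j). 2 * (5/3)^m * (f (Phiw w (q j)) - f (Phiw w (q i)))\<^sup>2"
  have "(5/3)^m * Em m f = (\<Sum>e\<in>edges m. ?d e)"
    unfolding edges_eq Em_eq_sum_cell_energy cell_energy_def
    by (simp add: sum.cartesian_product[symmetric] sum_distrib_left power2_commute algebra_simps)
  then have "ennreal ((5/3)^m * Em m f) = (\<Sum>e\<in>edges m. ennreal (?d e))"
    by (simp add: case_prod_unfold sum_ennreal)
  also have "\<dots> \<le> (\<Sum>(w,i,j)\<in>edges m. ennreal 80 * (ennreal ((5/3)^m) * besov_on {0..1} (clamp_edge_fun f w i j)))"
  proof (intro sum_mono, clarify)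
    fix w i j assume e: "(w, i, j) \<in> edges m"
    let ?D = "(f (Phiw w (q j)) - f (Phiw w (q i)))\<^sup>2"
    have "ennreal ?D \<le> ennreal 40 * besov_on {0..1} (clamp_edge_fun f w i j)"
      using endpoint_diff_le_besov_ennreal[OF continuous_clamp_edge_fun[OF f e]]
      by (simp add: clamp_edge_fun_eq edge_fun_0 edge_fun_1)
    then have "ennreal (2 * (5/3)^m) * ennreal ?D
        \<le> ennreal (2 * (5/3)^m) * (ennreal 40 * besov_on {0..1} (clamp_edge_fun f w i j))"
      by (rule mult_left_mono) simp
    also have "\<dots> = ennreal 80 * (ennreal ((5/3)^m) * besov_on {0..1} (clamp_edge_fun f w i j))"
    proof -
      have "ennreal (2 * (5/3)^m) * ennreal 40 = ennreal 80 * ennreal ((5/3)^m)"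
        unfolding ennreal_mult[symmetric, OF zero_le_numeral zero_le_power[OF divide_nonneg_nonneg[OF zero_le_numeral zero_le_numeral]]]
        by (subst ennreal_mult[symmetric]) simp_all
      then show ?thesis by (simp only: mult.assoc[symmetric])
    qed
    finally show "ennreal (2 * (5/3)^m * ?D)
        \<le> ennreal 80 * (ennreal ((5/3)^m) * besov_on {0..1} (clamp_edge_fun f w i j))"
      by (simp add: ennreal_mult)
  qed
  also have "\<dots> = ennreal 80 * Hnorm2 m f"
    unfolding Hnorm2_eq[OF f] by (simp add: sum_distrib_left case_prod_unfold)
  finally show ?thesis .
qed

section \<open>The two directions of the comparison\<close>

lemma Em_nonneg: "0 \<le> Em m f"
  by (simp add: Em_eq_sum_cell_energy sum_nonneg cell_energy_nonneg)

lemma Em_cong: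
  assumes "\<And>w i. w \<in> words m \<Longrightarrow> i \<in> {0,1,2} \<Longrightarrow> f (Phiw w (q i)) = g (Phiw w (q i))"
  shows "Em m f = Em m g"
  unfolding Em_eq_sum_cell_energy cell_energy_def using assms by simp

lemma trace_bound:
  assumes F: "F \<in> dom_E"
  shows "F \<in> Hbeta m" and "Hnorm2 m F \<le> ennreal (12600 * Energy F)"
proof -
  have "(\<lambda>n. (5/3)^n * Em n F) \<longlonglongrightarrow> Energy F"
    using F by (simp add: dom_E_def Energy_def convergent_LIMSEQ_iff)
  then have "(5/3)^n * Em n F \<le> Energy F" for n
    by (rule incseq_le[OF incseq_Em])
  moreover have c: "continuous_on (SGm m) F"
    using F by (intro continuous_on_subset[OF _ SGm_subset_SG]) (simp add: dom_E_def)
  ultimately show *: "Hnorm2 m F \<le> ennreal (12600 * Energy F)"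
    by (intro Hnorm2_le_energy)
  then show "F \<in> Hbeta m"
    using c by (auto simp: Hbeta_def intro: le_less_trans)
qed

lemma extension_exists:
  fixes f :: "nat \<Rightarrow> complex \<Rightarrow> real"
  assumes f: "\<And>m. f m \<in> Hbeta m"
    and B: "\<And>m. Hnorm2 m (f m) \<le> B" "B < \<infinity>"
    and consistent: "\<And>m m' x. m \<le> m' \<Longrightarrow> x \<in> SGm m \<Longrightarrow> f m' x = f m x"
  obtains F where "F \<in> dom_E" "\<And>m x. x \<in> SGm m \<Longrightarrow> F x = f m x"
    "ennreal (Energy F) \<le> ennreal 80 * (SUP m. Hnorm2 m (f m))"
proof -
  have cont: "continuous_on (SGm m) (f m)" for m using f by (simp add: Hbeta_def)
  \<comment> \<open>By consistency any level containing x gives the same value, so \<open>g\<close>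
    glues the given functions on the union of the graphs. Elsewhere its value is arbitrary.\<close>
  define g where "g x = f (LEAST m. x \<in> SGm m) x" for x
  have g: "g x = f m x" if "x \<in> SGm m" for x m
    unfolding g_def using consistent[of "LEAST m. x \<in> SGm m" m x] LeastI[of "\<lambda>m. x \<in> SGm m", OF that]
      Least_le[of "\<lambda>m. x \<in> SGm m", OF that] by simp
  have Em_g: "Em m g = Em m (f m)" for m
    by (intro Em_cong g vertex_in_SGm)
  have le: "ennreal ((5/3)^m * Em m g) \<le> ennreal 80 * Hnorm2 m (f m)" for m
    unfolding Em_g by (rule Em_le_Hnorm2[OF cont])
  obtain M where M: "0 \<le> M" "B = ennreal M" using B(2) by (cases B rule: ennreal_cases) auto
  have bound: "(5/3)^m * Em m g \<le> 80 * M" for m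
  proof -
    note le[of m]
    also have "ennreal 80 * Hnorm2 m (f m) \<le> ennreal 80 * ennreal M"
      unfolding M(2)[symmetric] by (rule mult_left_mono[OF B(1)]) simp
    also have "\<dots> = ennreal (80 * M)" using M(1) by (intro ennreal_mult[symmetric]) simp_all
    finally show ?thesis using M(1) by (subst (asm) ennreal_le_iff) simp_all
  qed
  have "uniformly_continuous_on gasket_vertices g"
  proof (rule finite_energy_uniformly_continuous)
    fix n w assume w: "w \<in> words n"
    have "cell_energy g w \<le> (\<Sum>w\<in>words n. cell_energy g w)"
      using w by (intro member_le_sum cell_energy_nonneg finite_words)
    also have "\<dots> \<le> Em n g"
      by (simp add: Em_eq_sum_cell_energy sum_nonneg cell_energy_nonneg)
    also have "\<dots> = (3/5)^n * ((5/3)^n * Em n g)"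
      by (simp flip: power_mult_distrib mult.assoc)
    also have "\<dots> \<le> (3/5)^n * (80 * M)"
      by (intro mult_left_mono bound) simp
    finally show "cell_energy g w \<le> (3/5)^n * (80 * M)" .
  qed
  from uniformly_continuous_on_extension_on_closure[OF this]
  obtain F where F: "uniformly_continuous_on SG F" "\<And>x. x \<in> gasket_vertices \<Longrightarrow> g x = F x"
    unfolding SG_eq by metis
  have cont_F: "continuous_on SG F" using F(1) by (rule uniformly_continuous_imp_continuous)
  \<comment> \<open>\<open>F\<close> was obtained from vertex values alone. On an edge,
    \<open>F\<close> and \<open>f m\<close> are both continuous and agree at the dyadic points,
    which are vertices.\<close>
  have F_eq: "F x = f m x" if x: "x \<in> SGm m" for m x
  proof -
    obtain w i j t where e: "(w, i, j) \<in> edges m" "t \<in> {0..1}" "x = edge w i j (t / 2^m)"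
      using x by (rule SGm_cases)
    then have w: "w \<in> words m" "i \<in> {0,1,2}" "j \<in> {0,1,2}" by (auto simp: edges_eq)
    let ?p = "\<lambda>n. edge w i j (dyadic_floor n t / 2^m)"
    have p: "?p \<longlonglongrightarrow> x"
      unfolding e(3) using e(2) by (intro edge_dyadic_floor_tendsto) simp
    have "dyadic_floor n t \<le> t" "0 \<le> dyadic_floor n t" for n
      using dyadic_index_bounds(1)[of t n] e(2) unfolding dyadic_floor_def by simp_all
    then have "dyadic_floor n t \<in> {0..1}" for n
      using e(2) order_trans[of "dyadic_floor n t" t 1] by simp
    then have p_SGm: "?p n \<in> SGm m" for n by (intro edge_in_SGm e(1))
    have "F (?p n) = f m (?p n)" for n
      using F(2)[OF edge_dyadic_floor_in_vertices[OF w e(2)]] g[OF p_SGm] by metis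
    moreover have "(\<lambda>n. F (?p n)) \<longlonglongrightarrow> F x"
      by (rule continuous_on_tendsto_compose[OF cont_F p]) (use x p_SGm SGm_subset_SG[of m] in \<open>auto intro!: always_eventually\<close>)
    moreover have "(\<lambda>n. f m (?p n)) \<longlonglongrightarrow> f m x"
      by (rule continuous_on_tendsto_compose[OF cont p x]) (use p_SGm in simp)
    ultimately show ?thesis using LIMSEQ_unique by auto
  qed
  have Em_F: "Em m F = Em m g" for m
    unfolding Em_g by (intro Em_cong F_eq vertex_in_SGm)
  have "convergent (\<lambda>m. (5/3)^m * Em m F)"
  proof (rule Bseq_mono_convergent)
    show "Bseq (\<lambda>m. (5/3)^m * Em m F)"
      using bound Em_nonneg by (intro BseqI'[of _ "80 * M"]) (simp add: Em_F)
    show "\<forall>m n. m \<le> n \<longrightarrow> (5/3)^m * Em m F \<le> (5/3)^n * Em n F"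
      using incseq_Em[of F] by (simp add: incseq_def)
  qed
  then have dom: "F \<in> dom_E" and lim: "(\<lambda>m. (5/3)^m * Em m F) \<longlonglongrightarrow> Energy F"
    using cont_F by (simp_all add: dom_E_def Energy_def convergent_LIMSEQ_iff)
  have "ennreal (Energy F) \<le> ennreal 80 * (SUP m. Hnorm2 m (f m))"
  \<comment> \<open>Each level energy of \<open>F\<close> is that of \<open>f m\<close>, hence
    bounded by the norm at the same level. The supremum is therefore reached without passing through
    the bound \<open>B\<close>.\<close>
  proof (rule LIMSEQ_le_const2[OF tendsto_ennrealI[OF lim]])
    have "ennreal ((5/3)^m * Em m F) \<le> ennreal 80 * (SUP m. Hnorm2 m (f m))" for m
      unfolding Em_F by (rule order_trans[OF le]) (intro mult_left_mono SUP_upper, auto)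
    then show "\<exists>N. \<forall>m\<ge>N. ennreal ((5/3)^m * Em m F) \<le> ennreal 80 * (SUP m. Hnorm2 m (f m))"
      by blast
  qed
  with dom F_eq show ?thesis by (rule that)
qed

theorem theorem5p3:
  shows "\<exists>c::real. c > 0 \<and>
    (\<forall>F\<in>dom_E. (\<forall>m. F \<in> Hbeta m) \<and> (\<exists>B. \<forall>m. Hnorm2 m F \<le> B \<and> B < \<infinity>) \<and>
        (SUP m. Hnorm2 m F) \<le> ennreal (c * Energy F)) \<and>
    (\<forall>f :: nat \<Rightarrow> complex \<Rightarrow> real.
        (\<forall>m. f m \<in> Hbeta m) \<longrightarrow>
        (\<exists>B. \<forall>m. Hnorm2 m (f m) \<le> B \<and> B < \<infinity>) \<longrightarrow>
        (\<forall>m m'. m \<le> m' \<longrightarrow> (\<forall>x\<in>SGm m. f m' x = f m x)) \<longrightarrow>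
        (\<exists>F\<in>dom_E. (\<forall>m. \<forall>x\<in>SGm m. F x = f m x) \<and>
            ennreal (Energy F) \<le> ennreal c * (SUP m. Hnorm2 m (f m))))"
\<comment> \<open>The larger of the constants 12600 for traces and 80 for extensions.\<close>
proof (rule exI[of _ 12600], intro conjI ballI allI impI)
  fix F m assume F: "F \<in> dom_E"
  show "F \<in> Hbeta m" by (rule trace_bound(1)[OF F])
next
  fix F assume F: "F \<in> dom_E"
  show "\<exists>B. \<forall>m. Hnorm2 m F \<le> B \<and> B < \<infinity>"
    using trace_bound(2)[OF F] by (intro exI[of _ "ennreal (12600 * Energy F)"]) simp
  show "(SUP m. Hnorm2 m F) \<le> ennreal (12600 * Energy F)"
    using trace_bound(2)[OF F] by (intro SUP_least)
next
  fix f :: "nat \<Rightarrow> complex \<Rightarrow> real"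
  assume f: "\<forall>m. f m \<in> Hbeta m" and bdd: "\<exists>B. \<forall>m. Hnorm2 m (f m) \<le> B \<and> B < \<infinity>"
    and con: "\<forall>m m'. m \<le> m' \<longrightarrow> (\<forall>x\<in>SGm m. f m' x = f m x)"
  obtain B where B: "\<And>m. Hnorm2 m (f m) \<le> B" "B < \<infinity>" using bdd by auto
  obtain F where F: "F \<in> dom_E" "\<And>m x. x \<in> SGm m \<Longrightarrow> F x = f m x"
    "ennreal (Energy F) \<le> ennreal 80 * (SUP m. Hnorm2 m (f m))"
    using extension_exists[of f B] f B con by blast
  note F(3)
  also have "ennreal 80 * (SUP m. Hnorm2 m (f m)) \<le> ennreal 12600 * (SUP m. Hnorm2 m (f m))"
    by (intro mult_right_mono ennreal_leI) auto
  finally show "\<exists>F\<in>dom_E. (\<forall>m. \<forall>x\<in>SGm m. F x = f m x) \<and>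
            ennreal (Energy F) \<le> ennreal 12600 * (SUP m. Hnorm2 m (f m))"
    using F by blast
qed simp

end
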